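(* Let $c>0$ and $L>0$, let $H:=[L^2(0,L)]^2$, let $A(u,v):=(-c\,\partial_x u,\ c\,\partial_x v)$ be the operator with domain $$D(A):=\{(u,v)\in[H^1(0,L)]^2;\ u(0)=v(L)=0\}\subset H,$$ and let $B(u,v):=(v,u)$ for $(u,v)\in H$. Then for any $\kappa>c/L$ there exist numbers $K,\epsilon_0>0$ such that for any $\epsilon\in(0,\epsilon_0)$, $$\|e^{t(A+\epsilon B)}\|_{\mathcal{L}(H)}\ge K e^{-(\kappa\ln\epsilon^{-1})t}\qquad\forall t\ge0 .$$
   Context: $(e^{t(A+\epsilon B)})_{t\ge0}$ denotes the strongly continuous semigroup on $H$ generated by $A+\epsilon B$, and $\|\cdot\|_{\mathcal{L}(H)}$ is the operator norm. *)

theory Defs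
  imports "HOL-Analysis.Analysis"
begin

section \<open>Square integrable functions modulo null sets\<close>

text \<open>
  The space is built once and for all over the real line; \<open>L\<^sup>2(0,L)\<close> is then the closed
  subspace of classes that vanish almost everywhere outside \<open>(0,L)\<close> (extension by zero).
\<close>

definition square_integrable :: "(real \<Rightarrow> 'a::euclidean_space) \<Rightarrow> bool" where
  "square_integrable f \<longleftrightarrow>
     f \<in> borel_measurable lborel \<and> integrable lborel (\<lambda>x. (norm (f x))\<^sup>2)"

definition L2_rel :: "(real \<Rightarrow> 'a::euclidean_space) \<Rightarrow> (real \<Rightarrow> 'a) \<Rightarrow> bool" where
  "L2_rel f g \<longleftrightarrow> square_integrable f \<and> square_integrable g \<and> (AE x in lborel. f x = g x)"

lemma square_integrable_0: "square_integrable (\<lambda>x. 0)"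
  by (simp add: square_integrable_def)

lemma square_integrable_inner:
  assumes "square_integrable f" "square_integrable g"
  shows "integrable lborel (\<lambda>x. f x \<bullet> g x)"
proof (rule Bochner_Integration.integrable_bound)
  show "integrable lborel (\<lambda>x. (norm (f x))\<^sup>2 + (norm (g x))\<^sup>2)"
    using assms by (simp add: square_integrable_def)
  show "(\<lambda>x. f x \<bullet> g x) \<in> borel_measurable lborel"
    using assms unfolding square_integrable_def by (intro borel_measurable_inner) auto
  have "\<bar>f x \<bullet> g x\<bar> \<le> (norm (f x))\<^sup>2 + (norm (g x))\<^sup>2" for x
  proof -
    have "\<bar>f x \<bullet> g x\<bar> \<le> norm (f x) * norm (g x)" by (rule Cauchy_Schwarz_ineq2)
    also have "\<dots> \<le> (norm (f x))\<^sup>2 + (norm (g x))\<^sup>2"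
      using sum_squares_bound[of "norm (f x)" "norm (g x)"]
        mult_nonneg_nonneg[OF norm_ge_zero norm_ge_zero, of "f x" "g x"] by linarith
    finally show ?thesis .
  qed
  then show "AE x in lborel. norm (f x \<bullet> g x) \<le> norm ((norm (f x))\<^sup>2 + (norm (g x))\<^sup>2)"
    by simp
qed

lemma square_integrable_add:
  assumes "square_integrable f" "square_integrable g"
  shows "square_integrable (\<lambda>x. f x + g x)"
proof -
  have eq: "(norm (f x + g x))\<^sup>2 = (norm (f x))\<^sup>2 + (norm (g x))\<^sup>2 + 2 * (f x \<bullet> g x)" for x
    by (simp add: power2_norm_eq_inner inner_add inner_commute)
  show ?thesis
    using assms square_integrable_inner[OF assms] unfolding square_integrable_def eq
    by (auto intro: borel_measurable_add)
qed

lemma square_integrable_scaleR: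
  "square_integrable f \<Longrightarrow> square_integrable (\<lambda>x. r *\<^sub>R f x)"
  by (auto simp: square_integrable_def power_mult_distrib intro: borel_measurable_scaleR)

lemma square_integrable_minus: "square_integrable f \<Longrightarrow> square_integrable (\<lambda>x. - f x)"
  by (simp add: square_integrable_def)

lemma square_integrable_diff:
  "square_integrable f \<Longrightarrow> square_integrable g \<Longrightarrow> square_integrable (\<lambda>x. f x - g x)"
  using square_integrable_add[OF _ square_integrable_minus, of f g] by simp

lemma part_equivp_L2_rel: "part_equivp L2_rel"
proof (rule part_equivpI)
  show "\<exists>f. L2_rel f f"
    using square_integrable_0 by (auto simp: L2_rel_def)
  show "symp L2_rel"
    by (rule sympI) (auto simp: L2_rel_def)
  show "transp L2_rel"
    by (rule transpI) (auto simp: L2_rel_def)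
qed

quotient_type (overloaded) 'a L2 = "real \<Rightarrow> 'a::euclidean_space" / partial: L2_rel
  by (rule part_equivp_L2_rel)

instantiation L2 :: (euclidean_space) real_vector
begin

lift_definition zero_L2 :: "'a L2" is "\<lambda>x. 0"
  by (simp add: L2_rel_def square_integrable_0)

lift_definition plus_L2 :: "'a L2 \<Rightarrow> 'a L2 \<Rightarrow> 'a L2" is "\<lambda>f g x. f x + g x"
  by (auto simp: L2_rel_def square_integrable_add)

lift_definition uminus_L2 :: "'a L2 \<Rightarrow> 'a L2" is "\<lambda>f x. - f x"
  by (auto simp: L2_rel_def square_integrable_minus)

lift_definition minus_L2 :: "'a L2 \<Rightarrow> 'a L2 \<Rightarrow> 'a L2" is "\<lambda>f g x. f x - g x"
  by (auto simp: L2_rel_def square_integrable_diff)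

lift_definition scaleR_L2 :: "real \<Rightarrow> 'a L2 \<Rightarrow> 'a L2" is "\<lambda>r f x. r *\<^sub>R f x"
  by (auto simp: L2_rel_def square_integrable_scaleR)

instance
  by standard
    (transfer; auto simp: L2_rel_def square_integrable_add square_integrable_minus
      square_integrable_diff square_integrable_scaleR square_integrable_0 algebra_simps)+

end

instantiation L2 :: (euclidean_space) real_inner
begin

lift_definition inner_L2 :: "'a L2 \<Rightarrow> 'a L2 \<Rightarrow> real" is "\<lambda>f g. LINT x|lborel. f x \<bullet> g x"
  unfolding L2_rel_def
  by (intro integral_cong_AE borel_measurable_inner) (auto simp: square_integrable_def)

definition norm_L2 :: "'a L2 \<Rightarrow> real" where
  "norm_L2 u = sqrt (u \<bullet> u)"

definition sgn_L2 :: "'a L2 \<Rightarrow> 'a L2" where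
  "sgn_L2 u = u /\<^sub>R norm u"

definition dist_L2 :: "'a L2 \<Rightarrow> 'a L2 \<Rightarrow> real" where
  "dist_L2 u v = norm (u - v)"

definition uniformity_L2 :: "('a L2 \<times> 'a L2) filter" where
  "uniformity_L2 = (INF e\<in>{0<..}. principal {(u, v). dist u v < e})"

definition open_L2 :: "'a L2 set \<Rightarrow> bool" where
  "open_L2 U = (\<forall>u\<in>U. \<forall>\<^sub>F (u', v) in uniformity. u' = u \<longrightarrow> v \<in> U)"

instance
proof
  fix u v w :: "'a L2" and r :: real
  show "dist u v = norm (u - v)" by (rule dist_L2_def)
  show "sgn u = u /\<^sub>R norm u" by (rule sgn_L2_def)
  show "(uniformity :: ('a L2 \<times> 'a L2) filter) = (INF e\<in>{0<..}. principal {(u, v). dist u v < e})"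
    by (rule uniformity_L2_def)
  show "open U = (\<forall>u\<in>U. \<forall>\<^sub>F (u', v) in uniformity. u' = u \<longrightarrow> v \<in> U)" for U :: "'a L2 set"
    by (rule open_L2_def)
  show "norm u = sqrt (u \<bullet> u)" by (rule norm_L2_def)
  show "u \<bullet> v = v \<bullet> u"
    by transfer (simp add: inner_commute)
  show "(u + v) \<bullet> w = u \<bullet> w + v \<bullet> w"
    by transfer (simp add: L2_rel_def inner_add_left square_integrable_inner)
  show "(r *\<^sub>R u) \<bullet> v = r * (u \<bullet> v)"
    by transfer simp
  show "0 \<le> u \<bullet> u"
    by transfer simp
  show "u \<bullet> u = 0 \<longleftrightarrow> u = 0"
  proof transfer
    fix f :: "real \<Rightarrow> 'a" assume "L2_rel f f"
    then have f: "square_integrable f" by (simp add: L2_rel_def)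
    have "(LINT x|lborel. f x \<bullet> f x) = 0 \<longleftrightarrow> (AE x in lborel. f x \<bullet> f x = 0)"
      by (rule integral_nonneg_eq_0_iff_AE) (auto simp: square_integrable_inner f)
    then show "(LINT x|lborel. f x \<bullet> f x) = 0 \<longleftrightarrow> L2_rel f (\<lambda>x. 0)"
      by (simp add: L2_rel_def f square_integrable_0)
  qed
qed

end

lemma square_integrable_rep_L2: "square_integrable (rep_L2 u)"
proof -
  have "L2_rel (rep_L2 u) (rep_L2 u)"
    by (rule Quotient_rep_reflp[OF Quotient_L2])
  then show ?thesis by (simp add: L2_rel_def)
qed

lemma norm_L2_eq: "norm u = sqrt (LINT x|lborel. (norm (rep_L2 u x))\<^sup>2)"
  by (simp add: norm_eq_sqrt_inner inner_L2.rep_eq power2_norm_eq_inner)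

lemma rep_abs_L2: "square_integrable f \<Longrightarrow> AE x in lborel. rep_L2 (abs_L2 f) x = f x"
  using Quotient_rep_abs[OF Quotient_L2, of f] by (auto simp: L2_rel_def)

lemma nn_integral_rep_L2_diff:
  "(\<integral>\<^sup>+x. ennreal ((norm (rep_L2 u x - rep_L2 v x))\<^sup>2) \<partial>lborel) = ennreal ((norm (u - v))\<^sup>2)"
proof -
  have sq: "square_integrable (\<lambda>x. rep_L2 u x - rep_L2 v x)"
    by (intro square_integrable_diff square_integrable_rep_L2)
  have "abs_L2 (rep_L2 u) - abs_L2 (rep_L2 v) = abs_L2 (\<lambda>x. rep_L2 u x - rep_L2 v x)"
    by (rule minus_L2.abs_eq) (simp_all add: L2_rel_def square_integrable_rep_L2)
  then have "u - v = abs_L2 (\<lambda>x. rep_L2 u x - rep_L2 v x)"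
    by (simp add: Quotient_abs_rep[OF Quotient_L2])
  then have ae: "AE x in lborel. rep_L2 (u - v) x = rep_L2 u x - rep_L2 v x"
    using rep_abs_L2[OF sq] by simp
  have "(norm (u - v))\<^sup>2 = (LINT x|lborel. (norm (rep_L2 (u - v) x))\<^sup>2)"
    by (simp add: norm_L2_eq)
  also have "\<dots> = (LINT x|lborel. (norm (rep_L2 u x - rep_L2 v x))\<^sup>2)"
    using ae sq square_integrable_rep_L2[of "u - v"]
    by (intro integral_cong_AE) (auto simp: square_integrable_def)
  finally show ?thesis
    using sq by (subst nn_integral_eq_integral) (auto simp: square_integrable_def)
qed

text \<open>Riesz--Fischer.\<close>

instance L2 :: (euclidean_space) complete_space
proof
  fix X :: "nat \<Rightarrow> 'a L2" assume X: "Cauchy X"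
  have "\<exists>N. \<forall>m\<ge>N. \<forall>n\<ge>N. norm (X m - X n) < (1/4) ^ k" for k
    using CauchyD[OF X, of "(1/4) ^ k"] by simp
  then obtain N where N: "\<And>k m n. m \<ge> N k \<Longrightarrow> n \<ge> N k \<Longrightarrow> norm (X m - X n) < (1/4) ^ k"
    by metis
  define r where "r k = k + (\<Sum>i\<le>k. N i)" for k
  have r: "strict_mono r"
    by (auto simp: strict_mono_Suc_iff r_def)
  have rN: "N k \<le> r j" if "k \<le> j" for k j
  proof -
    have "N k \<le> (\<Sum>i\<le>j. N i)" using that by (intro member_le_sum) auto
    then show ?thesis by (simp add: r_def)
  qed
  define f where "f k = rep_L2 (X (r k))" for k
  have f: "square_integrable (f k)" for k
    by (simp add: f_def square_integrable_rep_L2)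
  have fm [measurable]: "f k \<in> borel_measurable lborel" for k
    using f[of k] by (simp add: square_integrable_def)
  have close: "(\<integral>\<^sup>+x. ennreal ((norm (f k x - f j x))\<^sup>2) \<partial>lborel) \<le> ennreal ((1/16) ^ k)" if "k \<le> j" for k j
  proof -
    have "norm (X (r k) - X (r j)) \<le> (1/4) ^ k"
      using N[OF rN rN, of k k j] that by (simp add: less_imp_le)
    then have "(norm (X (r k) - X (r j)))\<^sup>2 \<le> ((1/4) ^ k)\<^sup>2"
      by (intro power_mono) auto
    also have "\<dots> = (1/16) ^ k"
      by (simp add: power2_eq_square flip: power_mult_distrib)
    finally show ?thesis
      unfolding f_def nn_integral_rep_L2_diff by (rule ennreal_leI)
  qed
  have "AE x in lborel. (\<Sum>k. ennreal (2 ^ k * (norm (f k x - f (Suc k) x))\<^sup>2)) \<noteq> \<infinity>"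
  proof (rule nn_integral_PInf_AE)
    have "(\<integral>\<^sup>+x. (\<Sum>k. ennreal (2 ^ k * (norm (f k x - f (Suc k) x))\<^sup>2)) \<partial>lborel)
       = (\<Sum>k. \<integral>\<^sup>+x. ennreal (2 ^ k * (norm (f k x - f (Suc k) x))\<^sup>2) \<partial>lborel)"
      by (intro nn_integral_suminf) measurable
    also have "\<dots> \<le> (\<Sum>k. ennreal ((1/8) ^ k))"
    proof (intro suminf_le summableI)
      fix k
      have "(\<integral>\<^sup>+x. ennreal (2 ^ k * (norm (f k x - f (Suc k) x))\<^sup>2) \<partial>lborel)
        = ennreal (2 ^ k) * (\<integral>\<^sup>+x. ennreal ((norm (f k x - f (Suc k) x))\<^sup>2) \<partial>lborel)"
        by (subst nn_integral_cmult[symmetric]) (auto simp: ennreal_mult)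
      also have "\<dots> \<le> ennreal (2 ^ k) * ennreal ((1/16) ^ k)"
        by (intro mult_left_mono close) auto
      also have "\<dots> = ennreal ((1/8) ^ k)"
        by (simp add: ennreal_mult[symmetric] flip: power_mult_distrib)
      finally show "(\<integral>\<^sup>+x. ennreal (2 ^ k * (norm (f k x - f (Suc k) x))\<^sup>2) \<partial>lborel)
        \<le> ennreal ((1/8) ^ k)" .
    qed
    also have "\<dots> = ennreal (\<Sum>k. (1/8) ^ k)"
      by (intro suminf_ennreal2) (auto intro: summable_geometric)
    also have "\<dots> < \<infinity>" by simp
    finally show "(\<integral>\<^sup>+x. (\<Sum>k. ennreal (2 ^ k * (norm (f k x - f (Suc k) x))\<^sup>2)) \<partial>lborel) \<noteq> \<infinity>"
      by simp
  qed measurable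
  then have conv: "AE x in lborel. (\<lambda>k. f k x) \<longlonglongrightarrow> lim (\<lambda>k. f k x)"
  proof eventually_elim
    case (elim x)
    define S where "S = (\<Sum>k. ennreal (2 ^ k * (norm (f k x - f (Suc k) x))\<^sup>2))"
    have S: "S < top" using elim unfolding S_def by (simp only: infinity_ennreal_def less_top)
    have bd: "norm (f (Suc k) x - f k x) \<le> sqrt (enn2real S) * (sqrt (1/2)) ^ k" for k
    proof -
      have "ennreal (2 ^ k * (norm (f k x - f (Suc k) x))\<^sup>2) \<le> S"
        unfolding S_def
        by (rule order_trans[OF _ sum_le_suminf[OF summableI, of "{k}"]]) auto
      then have "2 ^ k * (norm (f k x - f (Suc k) x))\<^sup>2 \<le> enn2real S"
        using enn2real_mono[OF _ S] enn2real_ennreal[of "2 ^ k * (norm (f k x - f (Suc k) x))\<^sup>2"]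
        by (metis mult_nonneg_nonneg zero_le_numeral zero_le_power zero_le_power2)
      then have "(norm (f k x - f (Suc k) x))\<^sup>2 \<le> enn2real S * (1/2) ^ k"
        by (simp add: power_divide field_simps)
      then have "norm (f k x - f (Suc k) x) \<le> sqrt (enn2real S * (1/2) ^ k)"
        by (rule real_le_rsqrt)
      then show ?thesis
        by (simp add: real_sqrt_mult real_sqrt_power norm_minus_commute)
    qed
    have "summable (\<lambda>k. f (Suc k) x - f k x)"
      by (rule summable_comparison_test'[OF _ bd]) (intro summable_mult summable_geometric, simp)
    then have "convergent (\<lambda>k. f k x)"
    proof -
      assume "summable (\<lambda>k. f (Suc k) x - f k x)"
      then have "convergent (\<lambda>n. \<Sum>k<n. f (Suc k) x - f k x)"
        by (simp add: summable_iff_convergent)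
      then have "convergent (\<lambda>n. f n x - f 0 x)"
        by (simp only: sum_lessThan_telescope[of "\<lambda>k. f k x"])
      then have "convergent (\<lambda>n. (f n x - f 0 x) + f 0 x)"
        by (intro convergent_add convergent_const)
      then show ?thesis by simp
    qed
    then show ?case by (simp add: convergent_LIMSEQ_iff)
  qed
  define g where "g x = lim (\<lambda>k. f k x)" for x
  have g [measurable]: "g \<in> borel_measurable lborel"
    unfolding g_def by (rule borel_measurable_lim_metric) measurable
  have fatou: "(\<integral>\<^sup>+x. ennreal ((norm (f k x - g x))\<^sup>2) \<partial>lborel) \<le> ennreal ((1/16) ^ k)" for k
  proof -
    have "(\<integral>\<^sup>+x. ennreal ((norm (f k x - g x))\<^sup>2) \<partial>lborel)
      = (\<integral>\<^sup>+x. liminf (\<lambda>j. ennreal ((norm (f k x - f j x))\<^sup>2)) \<partial>lborel)"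
    proof (rule nn_integral_cong_AE)
      show "AE x in lborel. ennreal ((norm (f k x - g x))\<^sup>2) = liminf (\<lambda>j. ennreal ((norm (f k x - f j x))\<^sup>2))"
        using conv
      proof eventually_elim
        case (elim x)
        then have "(\<lambda>j. ennreal ((norm (f k x - f j x))\<^sup>2)) \<longlonglongrightarrow> ennreal ((norm (f k x - g x))\<^sup>2)"
          unfolding g_def by (intro tendsto_intros)
        then show ?case by (metis lim_imp_Liminf sequentially_bot)
      qed
    qed
    also have "\<dots> \<le> liminf (\<lambda>j. \<integral>\<^sup>+x. ennreal ((norm (f k x - f j x))\<^sup>2) \<partial>lborel)"
      by (rule nn_integral_liminf) measurable
    also have "\<dots> \<le> liminf (\<lambda>j. ennreal ((1/16) ^ k))"
      by (rule Liminf_mono) (auto simp: eventually_sequentially intro!: exI[of _ k] close)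
    also have "\<dots> = ennreal ((1/16) ^ k)"
      by (simp add: Liminf_const)
    finally show ?thesis .
  qed
  have sqd: "square_integrable (\<lambda>x. f k x - g x)" for k
    unfolding square_integrable_def
  proof
    show "(\<lambda>x. f k x - g x) \<in> borel_measurable lborel" by measurable
    show "integrable lborel (\<lambda>x. (norm (f k x - g x))\<^sup>2)"
      using le_less_trans[OF fatou[of k] ennreal_less_top]
      by (intro integrableI_bounded) auto
  qed
  have sqg: "square_integrable g"
    using square_integrable_diff[OF f[of 0] sqd[of 0]] by simp
  have le: "norm (X (r k) - abs_L2 g) \<le> (1/4) ^ k" for k
  proof -
    have "ennreal ((norm (X (r k) - abs_L2 g))\<^sup>2)
      = (\<integral>\<^sup>+x. ennreal ((norm (f k x - rep_L2 (abs_L2 g) x))\<^sup>2) \<partial>lborel)"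
      by (simp add: nn_integral_rep_L2_diff[symmetric] f_def)
    also have "\<dots> = (\<integral>\<^sup>+x. ennreal ((norm (f k x - g x))\<^sup>2) \<partial>lborel)"
      using rep_abs_L2[OF sqg] by (intro nn_integral_cong_AE) auto
    also have "\<dots> \<le> ennreal ((1/16) ^ k)" by (rule fatou)
    finally have "(norm (X (r k) - abs_L2 g))\<^sup>2 \<le> (1/16) ^ k"
      by (simp add: ennreal_le_iff)
    also have "\<dots> = ((1/4) ^ k)\<^sup>2"
      by (simp add: power2_eq_square flip: power_mult_distrib)
    finally show ?thesis
      by (rule power2_le_imp_le) simp
  qed
  have "(\<lambda>k. (1/4 :: real) ^ k) \<longlonglongrightarrow> 0"
    by (rule LIMSEQ_power_zero) simp
  then have "(\<lambda>k. X (r k) - abs_L2 g) \<longlonglongrightarrow> 0"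
    by (rule Lim_null_comparison[OF always_eventually[OF allI[OF le]]])
  then have "(X \<circ> r) \<longlonglongrightarrow> abs_L2 g"
    unfolding o_def by (rule LIM_zero_cancel)
  then show "convergent X"
    using Cauchy_converges_subseq[OF X r] by (auto simp: convergent_def)
qed

instance L2 :: (euclidean_space) banach ..


section \<open>Sobolev functions on a bounded interval\<close>

definition L2_Ioo :: "real \<Rightarrow> 'a::euclidean_space L2 set" where
  "L2_Ioo L = {u. AE x in lborel. x \<notin> {0<..<L} \<longrightarrow> rep_L2 u x = 0}"

text \<open>
  Test functions on \<open>(0,L)\<close> are the compactly supported \<open>C\<^sup>1\<close> functions, as in Brezis'
  treatment of one-dimensional Sobolev spaces; by mollification they give the same weak
  derivatives as the compactly supported smooth functions. They are real valued, which by
  linearity also covers the case of complex valued \<open>u\<close>.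
\<close>

definition test_function :: "real \<Rightarrow> (real \<Rightarrow> real) \<Rightarrow> (real \<Rightarrow> real) \<Rightarrow> bool" where
  "test_function L \<phi> \<phi>' \<longleftrightarrow>
     (\<forall>x. (\<phi> has_real_derivative \<phi>' x) (at x)) \<and> continuous_on UNIV \<phi>' \<and>
     (\<exists>K. compact K \<and> K \<subseteq> {0<..<L} \<and> (\<forall>x. x \<notin> K \<longrightarrow> \<phi> x = 0))"

definition has_weak_deriv ::
  "real \<Rightarrow> 'a::euclidean_space L2 \<Rightarrow> 'a L2 \<Rightarrow> bool" where
  "has_weak_deriv L u g \<longleftrightarrow> u \<in> L2_Ioo L \<and> g \<in> L2_Ioo L \<and>
     (\<forall>\<phi> \<phi>'. test_function L \<phi> \<phi>' \<longrightarrow>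
        (LINT x:{0<..<L}|lborel. \<phi>' x *\<^sub>R rep_L2 u x) =
        - (LINT x:{0<..<L}|lborel. \<phi> x *\<^sub>R rep_L2 g x))"

definition H1 :: "real \<Rightarrow> 'a::euclidean_space L2 set" where
  "H1 L = {u. \<exists>g. has_weak_deriv L u g}"

definition weak_deriv :: "real \<Rightarrow> 'a::euclidean_space L2 \<Rightarrow> 'a L2" where
  "weak_deriv L u = (THE g. has_weak_deriv L u g)"

text \<open>
  The value at a point of \<open>[0,L]\<close> of an \<open>H\<^sup>1\<close> function is the value there of its
  representative that is continuous on \<open>[0,L]\<close>.
\<close>

definition has_value_at :: "real \<Rightarrow> 'a::euclidean_space L2 \<Rightarrow> real \<Rightarrow> 'a \<Rightarrow> bool" where
  "has_value_at L u a y \<longleftrightarrow>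
     (\<exists>f. continuous_on {0..L} f \<and> (AE x in lborel. x \<in> {0<..<L} \<longrightarrow> rep_L2 u x = f x) \<and> f a = y)"


section \<open>Strongly continuous semigroups on a closed subspace\<close>

text \<open>
  Linearity is required over the reals only. For complex valued functions this admits every
  complex linear semigroup, and a semigroup with a complex linear generator is itself complex
  linear.
\<close>

definition bounded_linear_self :: "'h::real_normed_vector set \<Rightarrow> ('h \<Rightarrow> 'h) \<Rightarrow> bool" where
  "bounded_linear_self X S \<longleftrightarrow>
     (\<forall>x\<in>X. S x \<in> X) \<and>
     (\<forall>x\<in>X. \<forall>y\<in>X. S (x + y) = S x + S y) \<and>
     (\<forall>r. \<forall>x\<in>X. S (r *\<^sub>R x) = r *\<^sub>R S x) \<and>
     (\<exists>M. \<forall>x\<in>X. norm (S x) \<le> M * norm x)"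

definition onorm_on :: "'h::real_normed_vector set \<Rightarrow> ('h \<Rightarrow> 'h) \<Rightarrow> real" where
  "onorm_on X S = (SUP x\<in>X. norm (S x) / norm x)"

definition C0_semigroup_on :: "'h::banach set \<Rightarrow> (real \<Rightarrow> 'h \<Rightarrow> 'h) \<Rightarrow> bool" where
  "C0_semigroup_on X T \<longleftrightarrow>
     (\<forall>t\<ge>0. bounded_linear_self X (T t)) \<and>
     (\<forall>x\<in>X. T 0 x = x) \<and>
     (\<forall>s\<ge>0. \<forall>t\<ge>0. \<forall>x\<in>X. T (s + t) x = T s (T t x)) \<and>
     (\<forall>x\<in>X. ((\<lambda>t. T t x) \<longlongrightarrow> x) (at_right 0))"

text \<open>
  The unbounded operator with domain \<open>D\<close> and action \<open>G\<close> is the infinitesimal generator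
  of \<open>T\<close>; in particular \<open>D\<close> is exactly the set where the difference quotients converge.
\<close>

definition generates ::
  "'h::banach set \<Rightarrow> 'h set \<Rightarrow> ('h \<Rightarrow> 'h) \<Rightarrow> (real \<Rightarrow> 'h \<Rightarrow> 'h) \<Rightarrow> bool" where
  "generates X D G T \<longleftrightarrow> C0_semigroup_on X T \<and>
     D = {x\<in>X. \<exists>y\<in>X. ((\<lambda>t. (T t x - x) /\<^sub>R t) \<longlongrightarrow> y) (at_right 0)} \<and>
     (\<forall>x\<in>D. ((\<lambda>t. (T t x - x) /\<^sub>R t) \<longlongrightarrow> G x) (at_right 0))"


section \<open>The operators\<close>

text \<open>
  The product type carries the norm \<open>sqrt ((norm u)\<^sup>2 + (norm v)\<^sup>2)\<close>. The intended value types
  are \<open>real\<close> and \<open>complex\<close>, the instances of \<open>{real_normed_field, euclidean_space}\<close>.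
\<close>

definition H_space :: "real \<Rightarrow> ('k::euclidean_space L2 \<times> 'k L2) set" where
  "H_space L = L2_Ioo L \<times> L2_Ioo L"

definition dom_A :: "real \<Rightarrow> ('k::euclidean_space L2 \<times> 'k L2) set" where
  "dom_A L = {(u, v). u \<in> H1 L \<and> v \<in> H1 L \<and> has_value_at L u 0 0 \<and> has_value_at L v L 0}"

definition op_A ::
  "real \<Rightarrow> real \<Rightarrow> 'k::euclidean_space L2 \<times> 'k L2 \<Rightarrow> 'k L2 \<times> 'k L2" where
  "op_A c L = (\<lambda>(u, v). (- c *\<^sub>R weak_deriv L u, c *\<^sub>R weak_deriv L v))"

definition op_B :: "'k::euclidean_space L2 \<times> 'k L2 \<Rightarrow> 'k L2 \<times> 'k L2" where
  "op_B = (\<lambda>(u, v). (v, u))"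

end

theory Submission
  imports Defs "HOL-Real_Asymp.Real_Asymp"
begin

text \<open>
  The constant \<open>K = 1\<close> works, because \<open>A + \<epsilon> B\<close> has a real eigenvalue
  \<open>l \<ge> - \<kappa> ln (1/\<epsilon>)\<close>, so that the semigroup multiplies an eigenvector by \<open>exp (l t)\<close>.
  The pair \<open>(sinh (\<mu> x), sinh (\<mu> (L - x)))\<close> satisfies the boundary conditions, and it is an
  eigenvector with \<open>l = - \<epsilon> cosh (\<mu> L)\<close> as soon as \<open>\<epsilon> sinh (\<mu> L) = c \<mu>\<close>. Since \<open>sinh (\<mu> L)\<close>
  grows exponentially, this equation has a solution \<open>\<mu> \<le> (k / c) ln (1/\<epsilon>)\<close> for every fixed
  \<open>k > c / L\<close> and small \<open>\<epsilon>\<close>; then \<open>l\<^sup>2 = \<epsilon>\<^sup>2 + (c \<mu>)\<^sup>2\<close> gives the bound on \<open>l\<close> when \<open>k < \<kappa>\<close>.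
\<close>

section \<open>Eigenvectors of generators\<close>

text \<open>
  Uniform boundedness: each orbit is bounded near \<open>0\<close>, so by Baire one of the closed sets of
  vectors with orbit bounded by \<open>n\<close> on \<open>[0, 1/(n+1)]\<close> has interior.
\<close>

lemma C0_semigroup_bounded_near_0:
  fixes X :: "'h::banach set"
  assumes T: "C0_semigroup_on X T" and "closed X" and X: "subspace X"
  obtains \<delta> M where "\<delta> > 0"
    and "\<And>t x. 0 \<le> t \<Longrightarrow> t \<le> \<delta> \<Longrightarrow> x \<in> X \<Longrightarrow> norm (T t x) \<le> M * norm x"
proof -
  have bl: "bounded_linear_self X (T t)" if "t \<ge> 0" for t
    using T that by (simp add: C0_semigroup_on_def)
  have T_diff: "T t (x - y) = T t x - T t y" if "t \<ge> 0" "x \<in> X" "y \<in> X" for t x y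
  proof -
    have "T t (x + (-1) *\<^sub>R y) = T t x + (-1) *\<^sub>R T t y"
      using bl[OF that(1)] that(2,3) subspace_scale[OF X, of y "-1"]
      unfolding bounded_linear_self_def by metis
    then show ?thesis by simp
  qed
  have cont: "continuous_on X (T t)" if t: "t \<ge> 0" for t
  proof -
    obtain M where M: "norm (T t x) \<le> M * norm x" if "x \<in> X" for x
      using bl[OF t] unfolding bounded_linear_self_def by blast
    have "\<bar>M\<bar>-lipschitz_on X (T t)"
    proof (rule lipschitz_onI)
      fix x y assume "x \<in> X" "y \<in> X"
      then have "norm (T t x - T t y) \<le> M * norm (x - y)"
        using M[of "x - y"] subspace_diff[OF X] T_diff[OF t] by metis
      also have "\<dots> \<le> \<bar>M\<bar> * norm (x - y)" by (intro mult_right_mono) auto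
      finally show "dist (T t x) (T t y) \<le> \<bar>M\<bar> * dist x y" by (simp add: dist_norm)
    qed simp
    then show ?thesis by (rule lipschitz_on_continuous_on)
  qed
  \<comment> \<open>The index \<open>n\<close> sets both the bound and the time window, so one
    countable family weakens both requirements as \<open>n\<close> grows. \<open>Suc\<close> keeps
    the window nondegenerate at \<open>n = 0\<close>.\<close>
  define V where "V n = {x \<in> X. \<forall>t\<in>{0..inverse (Suc n)}. norm (T t x) \<le> real n}" for n :: nat
  have "closed (V n)" for n
  proof -
    have "V n = X \<inter> (\<Inter>t\<in>{0..inverse (Suc n)}. {x \<in> X. norm (T t x) \<le> real n})"
      by (auto simp: V_def)
    moreover have "closed {x \<in> X. norm (T t x) \<le> real n}" if "t \<in> {0..inverse (Suc n)}" for t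
      using that by (intro continuous_on_closed_Collect_le continuous_intros cont \<open>closed X\<close>) auto
    ultimately show ?thesis using \<open>closed X\<close> by (metis (no_types, lifting) closed_Int closed_INT)
  qed
  then have closedin: "closedin (top_of_set X) (V n)" for n
    by (auto simp: V_def intro!: closed_subset)
  have cover: "(\<Union>n. V n) = X"
  proof (intro equalityI subsetI)
    fix x assume x: "x \<in> X"
    have "((\<lambda>t. T t x) \<longlongrightarrow> x) (at_right 0)"
      using T x by (simp add: C0_semigroup_on_def)
    then have "eventually (\<lambda>t. dist (T t x) x < 1) (at_right 0)"
      by (rule tendstoD) simp
    then obtain d where d: "d > 0" "\<And>t. 0 < t \<Longrightarrow> t < d \<Longrightarrow> dist (T t x) x < 1"
      by (auto simp: eventually_at_right_field)
    have bd: "norm (T t x) \<le> norm x + 1" if "0 \<le> t" "t < d" for t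
    proof (cases "t = 0")
      case True
      then show ?thesis using T x by (simp add: C0_semigroup_on_def)
    next
      case False
      then have "norm (T t x - x) < 1" using d(2)[of t] that by (simp add: dist_norm)
      then show ?thesis using norm_triangle_ineq2[of "T t x" x] by linarith
    qed
    \<comment> \<open>\<open>n1\<close> makes the window shorter than \<open>d\<close>,
      \<open>n2\<close> makes the bound exceed \<open>norm x + 1\<close>; their maximum achieves
      both.\<close>
    obtain n1 where n1: "inverse (Suc n1) < d" using d(1) reals_Archimedean by blast
    obtain n2 :: nat where n2: "norm x + 1 \<le> n2" using real_arch_simple by blast
    have "inverse (real (Suc (max n1 n2))) \<le> inverse (real (Suc n1))"
      by (intro le_imp_inverse_le) auto
    moreover have "norm x + 1 \<le> real (max n1 n2)" using n2 by simp
    ultimately have "norm (T t x) \<le> real (max n1 n2)"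
      if "t \<in> {0..inverse (real (Suc (max n1 n2)))}" for t
      using that n1 bd[of t] by (metis atLeastAtMost_iff order_trans le_less_trans)
    then have "x \<in> V (max n1 n2)" using x by (simp add: V_def)
    then show "x \<in> (\<Union>n. V n)" by blast
  qed (auto simp: V_def)
  \<comment> \<open>Baire in \<open>X\<close>, which is completely metrizable because it is closed:
    if every \<open>V n\<close> had empty relative interior, so would their union \<open>X\<close>,
    which contains 0.\<close>
  have "\<exists>n. top_of_set X interior_of V n \<noteq> {}"
  proof (rule ccontr)
    assume "\<nexists>n. top_of_set X interior_of V n \<noteq> {}"
    then have "top_of_set X interior_of \<Union>(range V) = {}"
      using completely_metrizable_space_closedin[OF completely_metrizable_space_euclidean, of X]
        \<open>closed X\<close> closedin
      by (intro Baire_category_alt) auto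
    moreover have "top_of_set X interior_of X = X"
      using interior_of_topspace[of "top_of_set X"] by simp
    ultimately show False using cover X subspace_0 by auto
  qed
  then obtain n U x0 where U: "openin (top_of_set X) U" "x0 \<in> U" "U \<subseteq> V n"
    by (auto simp: interior_of_def)
  then obtain r where r: "r > 0" "ball x0 r \<inter> X \<subseteq> V n"
    by (auto simp: openin_contains_ball)
  have x0: "x0 \<in> V n" "x0 \<in> X" using U by (auto simp: V_def)
  show ?thesis
  proof
    show "inverse (real (Suc n)) > 0" by simp
    fix t x assume t: "0 \<le> t" "t \<le> inverse (real (Suc n))" and x: "x \<in> X"
    \<comment> \<open>Rescaled to length \<open>r / 2\<close>, the vector \<open>x\<close> keeps
      \<open>x0 + s *\<^sub>R x\<close> in the ball. So \<open>s *\<^sub>R T t x\<close> is a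
      difference of two vectors of norm at most \<open>n\<close>, and dividing \<open>2 * n\<close>
      by \<open>s\<close> gives the constant \<open>4 * n / r\<close>.\<close>
    show "norm (T t x) \<le> (4 * n / r) * norm x"
    proof (cases "x = 0")
      case True
      then show ?thesis using T_diff[OF t(1) x x] by simp
    next
      case False
      define s where "s = r / 2 / norm x"
      have s: "s > 0" using False r by (simp add: s_def)
      have "x0 + s *\<^sub>R x \<in> ball x0 r \<inter> X"
        using x0 x r False subspace_add[OF X] subspace_scale[OF X]
        by (auto simp: dist_norm s_def)
      then have "norm (T t (x0 + s *\<^sub>R x)) \<le> n" "norm (T t x0) \<le> n"
        using r x0 t by (auto simp: V_def)
      moreover have "T t (x0 + s *\<^sub>R x) = T t x0 + s *\<^sub>R T t x"
        using bl[OF t(1)] x0 x subspace_scale[OF X] unfolding bounded_linear_self_def by metis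
      ultimately have "norm (s *\<^sub>R T t x) \<le> 2 * n"
        using norm_triangle_ineq4[of "T t x0 + s *\<^sub>R T t x" "T t x0"] by simp
      then show ?thesis using s r False by (simp add: s_def field_simps)
    qed
  qed
qed

text \<open>Over a short time \<open>h\<close> the orbit of \<open>z\<close> differs from
  \<open>exp (l * h) *\<^sub>R z\<close> by a defect of size o(h). Cutting \<open>t\<close> into n
  equal pieces adds up n defects of size o(t/n), each amplified by at most the local bound
  \<open>M\<close>, so the total error tends to 0. This settles times up to \<open>\<delta>\<close>;
  the semigroup law carries the identity to all times.\<close>

lemma generator_eigenvector:
  fixes X :: "'h::banach set"
  assumes gen: "generates X D G T" and "closed X" and X: "subspace X"
    and z: "z \<in> D" "G z = l *\<^sub>R z" and "l \<le> 0" and "t \<ge> 0"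
  shows "T t z = exp (l * t) *\<^sub>R z"
proof -
  have T: "C0_semigroup_on X T" and zX: "z \<in> X"
    and lim: "((\<lambda>t. (T t z - z) /\<^sub>R t) \<longlongrightarrow> l *\<^sub>R z) (at_right 0)"
    using gen z unfolding generates_def by (blast, blast, metis)
  have bl: "bounded_linear_self X (T t)" if "t \<ge> 0" for t
    using T that by (simp add: C0_semigroup_on_def)
  have T0: "T 0 x = x" if "x \<in> X" for x
    using T that by (simp add: C0_semigroup_on_def)
  have T_plus: "T (s + t) x = T s (T t x)" if "s \<ge> 0" "t \<ge> 0" "x \<in> X" for s t x
    using T that by (simp add: C0_semigroup_on_def)
  obtain \<delta> M where \<delta>: "\<delta> > 0"
    and M: "\<And>t x. 0 \<le> t \<Longrightarrow> t \<le> \<delta> \<Longrightarrow> x \<in> X \<Longrightarrow> norm (T t x) \<le> M * norm x"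
    using C0_semigroup_bounded_near_0[OF T \<open>closed X\<close> X] by blast
  \<comment> \<open>The error after \<open>Suc k\<close> steps is the new defect moved by
    \<open>T (real k * h)\<close> plus \<open>exp (l * h)\<close> times the previous error. The
    first part costs a factor \<open>M\<close>, as the elapsed time stays below
    \<open>\<delta>\<close>; the second is not amplified because \<open>l \<le> 0\<close>.\<close>
  have step: "norm (T (real k * h) z - exp (l * (real k * h)) *\<^sub>R z)
      \<le> real k * (M * norm (T h z - exp (l * h) *\<^sub>R z))"
    if h: "0 \<le> h" and "real k * h \<le> \<delta>" for h k
    using that(2)
  proof (induction k)
    case 0
    then show ?case by (simp add: T0 zX)
  next
    case (Suc k)
    define d where "d = T h z - exp (l * h) *\<^sub>R z"
    have hz: "T h z \<in> X" using bl[OF h] zX by (auto simp: bounded_linear_self_def)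
    have ez: "exp (l * h) *\<^sub>R z \<in> X" using X zX by (simp add: subspace_scale)
    have dX: "d \<in> X" unfolding d_def using hz ez X by (simp add: subspace_diff)
    have kh: "0 \<le> real k * h" "real k * h \<le> \<delta>"
      using Suc.prems h by (auto simp: algebra_simps)
    have "T h z = d + exp (l * h) *\<^sub>R z" by (simp add: d_def)
    then have "T (real k * h) (T h z) = T (real k * h) d + exp (l * h) *\<^sub>R T (real k * h) z"
      using bl[OF kh(1)] dX ez zX unfolding bounded_linear_self_def by metis
    moreover have "T (real (Suc k) * h) z = T (real k * h) (T h z)"
      using T_plus[OF kh(1) h zX] by (simp add: algebra_simps)
    ultimately have "T (real (Suc k) * h) z - exp (l * (real (Suc k) * h)) *\<^sub>R z
        = T (real k * h) d + exp (l * h) *\<^sub>R (T (real k * h) z - exp (l * (real k * h)) *\<^sub>R z)"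
      by (simp add: algebra_simps exp_add)
    also have "norm \<dots> \<le> norm (T (real k * h) d)
        + exp (l * h) * norm (T (real k * h) z - exp (l * (real k * h)) *\<^sub>R z)"
      by (rule order_trans[OF norm_triangle_ineq]) simp
    also have "\<dots> \<le> M * norm d + 1 * (real k * (M * norm d))"
    proof (intro add_mono mult_mono)
      show "norm (T (real k * h) d) \<le> M * norm d" using M[OF kh dX] .
      show "norm (T (real k * h) z - exp (l * (real k * h)) *\<^sub>R z) \<le> real k * (M * norm d)"
        using Suc.IH[OF kh(2)] by (simp add: d_def)
      show "exp (l * h) \<le> 1" using h \<open>l \<le> 0\<close> by (simp add: mult_nonpos_nonneg)
    qed auto
    finally show ?case by (simp add: d_def algebra_simps)
  qed
  \<comment> \<open>The difference quotients at 0 of the orbit and of the exponential have the same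
    limit \<open>l *\<^sub>R z\<close>.\<close>
  have defect: "((\<lambda>h. (T h z - exp (l * h) *\<^sub>R z) /\<^sub>R h) \<longlongrightarrow> 0) (at_right 0)"
  proof -
    have "((\<lambda>h. exp (l * h)) has_real_derivative l) (at 0)"
      by (auto intro!: derivative_eq_intros)
    then have "((\<lambda>h. (exp (l * h) - 1) / h) \<longlongrightarrow> l) (at 0)"
      by (simp add: has_field_derivative_iff)
    then have "((\<lambda>h. ((exp (l * h) - 1) / h) *\<^sub>R z) \<longlongrightarrow> l *\<^sub>R z) (at_right 0)"
      by (intro tendsto_intros) (rule filterlim_mono[OF _ order_refl at_le], auto)
    from tendsto_diff[OF lim this] show ?thesis
      by (simp add: algebra_simps divide_inverse)
  qed
  have small: "T t z = exp (l * t) *\<^sub>R z" if t: "0 < t" "t \<le> \<delta>" for t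
  proof -
    \<comment> \<open>In terms of the defect per unit time, the bound from \<open>step\<close> for
      \<open>Suc n\<close> pieces of length \<open>t / Suc n\<close> becomes
      \<open>t * \<bar>M\<bar> * norm (e (t / Suc n))\<close>; the absolute value is there because
      no sign of \<open>M\<close> is known.\<close>
    define e where "e h = (T h z - exp (l * h) *\<^sub>R z) /\<^sub>R h" for h
    have "eventually (\<lambda>n. t / real (Suc n) \<in> {0<..}) sequentially"
      using t by (intro always_eventually) auto
    with LIMSEQ_Suc[OF lim_const_over_n[of t]]
    have "filterlim (\<lambda>n. t / real (Suc n)) (at_right 0) sequentially"
      by (simp only: filterlim_at) (auto elim!: eventually_mono)
    then have "(\<lambda>n. e (t / real (Suc n))) \<longlonglongrightarrow> 0"
      using defect unfolding e_def by (rule filterlim_compose[rotated])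
    then have lim0: "(\<lambda>n. t * \<bar>M\<bar> * norm (e (t / real (Suc n)))) \<longlonglongrightarrow> 0"
      by (auto intro!: tendsto_eq_intros)
    have "norm (T t z - exp (l * t) *\<^sub>R z) \<le> t * \<bar>M\<bar> * norm (e (t / real (Suc n)))" for n
    proof -
      let ?h = "t / real (Suc n)"
      have "real (Suc n) * ?h = t" by simp
      then have "norm (T t z - exp (l * t) *\<^sub>R z)
          \<le> real (Suc n) * (M * norm (T ?h z - exp (l * ?h) *\<^sub>R z))"
        using step[of ?h "Suc n"] t by (metis divide_nonneg_nonneg less_imp_le of_nat_0_le_iff)
      also have "\<dots> \<le> real (Suc n) * (\<bar>M\<bar> * norm (T ?h z - exp (l * ?h) *\<^sub>R z))"
        by (intro mult_left_mono mult_right_mono) auto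
      also have "T ?h z - exp (l * ?h) *\<^sub>R z = ?h *\<^sub>R e ?h"
        using t by (simp add: e_def)
      also have "norm (?h *\<^sub>R e ?h) = ?h * norm (e ?h)" using t by simp
      also have "real (Suc n) * (\<bar>M\<bar> * (?h * norm (e ?h))) = t * \<bar>M\<bar> * norm (e ?h)"
        by (simp del: of_nat_Suc)
      finally show ?thesis .
    qed
    then have "norm (T t z - exp (l * t) *\<^sub>R z) \<le> 0"
      by (intro tendsto_lowerbound[OF lim0] always_eventually allI) simp_all
    then show ?thesis by simp
  qed
  \<comment> \<open>This many pieces bring the step \<open>t / Suc n\<close> below
    \<open>\<delta>\<close>, where the identity is known; iterating it \<open>Suc n\<close> times
    reaches \<open>t\<close>.\<close>
  obtain n where n: "t / \<delta> \<le> real n" using real_arch_simple by blast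
  define h where "h = t / real (Suc n)"
  have h: "0 \<le> h" "h \<le> \<delta>"
  proof -
    show "0 \<le> h" using \<open>t \<ge> 0\<close> by (simp add: h_def)
    have "t \<le> real (Suc n) * \<delta>" using n \<delta> by (simp add: field_simps)
    then show "h \<le> \<delta>" by (simp add: h_def field_simps)
  qed
  have Th: "T h z = exp (l * h) *\<^sub>R z"
    using small[of h] h T0[OF zX] by (cases "h = 0") auto
  have "T (real k * h) z = exp (l * (real k * h)) *\<^sub>R z" for k
  proof (induction k)
    case 0
    then show ?case by (simp add: T0 zX)
  next
    case (Suc k)
    have "T (real (Suc k) * h) z = T h (T (real k * h) z)"
      using T_plus[of h "real k * h" z] h zX by (simp add: algebra_simps)
    also have "\<dots> = exp (l * (real k * h)) *\<^sub>R T h z"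
      using bl[OF h(1)] zX unfolding Suc.IH bounded_linear_self_def by blast
    finally show ?case by (simp add: Th algebra_simps exp_add)
  qed
  from this[of "Suc n"] show ?thesis by (simp add: h_def)
qed

text \<open>A real supremum dominates its members only if they are bounded above, which the
  boundedness of \<open>S\<close> provides. At 0 the quotient is 0 by convention, so the upper bound
  is taken as \<open>\<bar>M\<bar>\<close>.\<close>

lemma onorm_on_ge:
  assumes "bounded_linear_self X S" "x \<in> X"
  shows "norm (S x) / norm x \<le> onorm_on X S"
proof -
  obtain M where M: "\<And>y. y \<in> X \<Longrightarrow> norm (S y) \<le> M * norm y"
    using assms unfolding bounded_linear_self_def by blast
  have "norm (S y) / norm y \<le> \<bar>M\<bar>" if "y \<in> X" for y
  proof (cases "y = 0")
    case False
    have "norm (S y) \<le> \<bar>M\<bar> * norm y"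
      using M[OF that] mult_right_mono[OF abs_ge_self[of M] norm_ge_zero[of y]] by linarith
    then show ?thesis using False by (simp add: divide_le_eq)
  qed simp
  then show ?thesis
    unfolding onorm_on_def using assms by (intro cSUP_upper bdd_aboveI2) auto
qed

section \<open>Uniqueness of weak derivatives\<close>

text \<open>Squaring removes the kink of \<open>max 0 y\<close>: at the origin the difference
  quotient is at most \<open>\<bar>h\<bar>\<close> in absolute value. This makes the bumps below
  continuously differentiable.\<close>

lemma has_real_derivative_max_0_square:
  "((\<lambda>y. (max 0 y)\<^sup>2) has_real_derivative 2 * max 0 x) (at x)"
proof -
  consider "x > 0" | "x < 0" | "x = 0" by linarith
  then show ?thesis
  proof cases
    case 1
    have "((\<lambda>y. y\<^sup>2) has_real_derivative 2 * x) (at x)"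
      by (auto intro!: derivative_eq_intros)
    then have "((\<lambda>y. (max 0 y)\<^sup>2) has_real_derivative 2 * x) (at x)"
      by (rule has_field_derivative_transform_within_open[where S = "{0<..}"]) (use 1 in auto)
    then show ?thesis using 1 by simp
  next
    case 2
    have "((\<lambda>y. (max 0 y)\<^sup>2) has_real_derivative 0) (at x)"
      by (rule has_field_derivative_transform_within_open[where S = "{..<0}" and f = "\<lambda>y. 0"])
        (use 2 in auto)
    then show ?thesis using 2 by simp
  next
    case 3
    have "((\<lambda>h. (max 0 h)\<^sup>2 / h) \<longlongrightarrow> 0) (at (0::real))"
    proof (rule Lim_null_comparison)
      show "eventually (\<lambda>h. norm ((max 0 h)\<^sup>2 / h) \<le> \<bar>h\<bar>) (at (0::real))"
        by (intro always_eventually allI) (auto simp: max_def power2_eq_square)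
      show "((\<lambda>h. \<bar>h\<bar>) \<longlongrightarrow> 0) (at (0::real))"
        by (auto intro!: tendsto_eq_intros)
    qed
    then show ?thesis using 3 by (simp add: has_field_derivative_iff)
  qed
qed

text \<open>
  A \<open>C\<^sup>1\<close> function with \<open>saturation (n y) \<longlonglongrightarrow> 1\<close> for \<open>y > 0\<close> that vanishes for \<open>y \<le> 0\<close>; at
  \<open>y = (x - a) (b - x)\<close> this gives test functions converging to the indicator of \<open>(a, b)\<close>.
\<close>

definition saturation :: "real \<Rightarrow> real" where
  "saturation y = (max 0 y)\<^sup>2 / (1 + (max 0 y)\<^sup>2)"

definition saturation_deriv :: "real \<Rightarrow> real" where
  "saturation_deriv y = 2 * max 0 y / (1 + (max 0 y)\<^sup>2)\<^sup>2"

lemma saturation_bounds: "0 \<le> saturation y" "saturation y \<le> 1"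
  by (auto simp: saturation_def add_nonneg_eq_0_iff divide_le_eq_1 add_pos_nonneg)

lemma saturation_nonpos: "y \<le> 0 \<Longrightarrow> saturation y = 0"
  by (simp add: saturation_def)

lemma one_plus_square_neq_0: "1 + y\<^sup>2 \<noteq> (0::real)"
  by (metis add_nonneg_eq_0_iff zero_le_one zero_le_power2 zero_neq_one)

lemma saturation_has_derivative:
  "(saturation has_real_derivative saturation_deriv x) (at x)"
proof -
  have "((\<lambda>y. (max 0 y)\<^sup>2 / (1 + (max 0 y)\<^sup>2)) has_real_derivative
      (2 * max 0 x * (1 + (max 0 x)\<^sup>2) - (max 0 x)\<^sup>2 * (0 + 2 * max 0 x))
      / ((1 + (max 0 x)\<^sup>2) * (1 + (max 0 x)\<^sup>2))) (at x)"
    by (intro DERIV_divide DERIV_add DERIV_const has_real_derivative_max_0_square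
        one_plus_square_neq_0)
  then show ?thesis
    by (simp add: saturation_def[abs_def] saturation_deriv_def algebra_simps power2_eq_square)
qed

lemma tendsto_saturation:
  assumes "y > 0"
  shows "(\<lambda>n. saturation (real n * y)) \<longlonglongrightarrow> 1"
proof -
  have inf: "filterlim (\<lambda>n. real n * y) at_top sequentially"
    using assms by (intro filterlim_at_top_mult_tendsto_pos[OF tendsto_const] filterlim_real_sequentially)
  have "(\<lambda>n. 1 - inverse (1 + (real n * y)\<^sup>2)) \<longlonglongrightarrow> 1 - 0"
    by (intro tendsto_intros tendsto_inverse_0_at_top filterlim_tendsto_add_at_top[OF tendsto_const]
        filterlim_pow_at_top inf) auto
  moreover have "saturation (real n * y) = 1 - inverse (1 + (real n * y)\<^sup>2)" for n
    using assms one_plus_square_neq_0[of "real n * y"] by (simp add: saturation_def field_simps)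
  ultimately show ?thesis by simp
qed

text \<open>The parabola \<open>(x - a) * (b - x)\<close> is nonpositive outside
  \<open>[a, b]\<close>, where \<open>saturation\<close> vanishes, so this compact interval inside
  \<open>(0, L)\<close> contains the support.\<close>

lemma test_function_bump:
  assumes "0 < a" "a \<le> b" "b < L"
  shows "test_function L (\<lambda>x. saturation (real n * ((x - a) * (b - x))))
    (\<lambda>x. saturation_deriv (real n * ((x - a) * (b - x))) * (real n * (a + b - 2 * x)))"
  unfolding test_function_def
proof (intro conjI allI)
  fix x
  show "((\<lambda>x. saturation (real n * ((x - a) * (b - x)))) has_real_derivative
      saturation_deriv (real n * ((x - a) * (b - x))) * (real n * (a + b - 2 * x))) (at x)"
    by (rule DERIV_chain2[OF saturation_has_derivative])
      (auto intro!: derivative_eq_intros simp: algebra_simps)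
  show "continuous_on UNIV
      (\<lambda>x. saturation_deriv (real n * ((x - a) * (b - x))) * (real n * (a + b - 2 * x)))"
    unfolding saturation_deriv_def by (intro continuous_intros) (auto simp: one_plus_square_neq_0)
  show "\<exists>K. compact K \<and> K \<subseteq> {0<..<L} \<and>
      (\<forall>x. x \<notin> K \<longrightarrow> saturation (real n * ((x - a) * (b - x))) = 0)"
  proof (intro exI[of _ "{a..b}"] conjI allI impI)
    fix x assume "x \<notin> {a..b}"
    then have "(x - a) * (b - x) \<le> 0"
      using assms by (auto simp: mult_le_0_iff)
    then show "saturation (real n * ((x - a) * (b - x))) = 0"
      by (intro saturation_nonpos mult_nonneg_nonpos[of "real n"]) auto
  qed (use assms in auto)
qed

section \<open>Integrability on bounded intervals and the fundamental lemma of the calculus of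
  variations\<close>

lemma set_integrable_square_integrable:
  assumes "square_integrable f"
  shows "set_integrable lborel {a<..<b} f"
  unfolding set_integrable_def
proof (rule Bochner_Integration.integrable_bound)
  have f [measurable]: "f \<in> borel_measurable lborel"
    and "integrable lborel (\<lambda>x. (norm (f x))\<^sup>2)"
    using assms by (auto simp: square_integrable_def)
  moreover have "emeasure lborel {a<..<b} < \<infinity>"
    by (rule emeasure_bounded_finite) simp
  ultimately show "integrable lborel (\<lambda>x. indicator {a<..<b} x + (norm (f x))\<^sup>2)"
    by (intro Bochner_Integration.integrable_add integrable_real_indicator) auto
  show "(\<lambda>x. indicator {a<..<b} x *\<^sub>R f x) \<in> borel_measurable lborel" by measurable
  \<comment> \<open>The domination that embeds square integrable functions into integrable ones on a
    set of finite measure.\<close>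
  have "norm (f x) \<le> 1 + (norm (f x))\<^sup>2" for x
    using sum_squares_bound[of "norm (f x)" 1] norm_ge_zero[of "f x"]
    unfolding power_one mult_1_right by linarith
  then show "AE x in lborel. norm (indicator {a<..<b} x *\<^sub>R f x) \<le> norm (indicator {a<..<b} x + (norm (f x))\<^sup>2)"
    by (intro always_eventually allI) (auto simp: indicator_def)
qed

lemma test_function_continuous: "test_function L \<phi> \<phi>' \<Longrightarrow> continuous_on S \<phi>"
  unfolding test_function_def
  by (meson DERIV_isCont continuous_at_imp_continuous_on)

lemma set_integrable_scaleR_continuous:
  fixes f :: "real \<Rightarrow> 'a::euclidean_space"
  assumes f: "set_integrable lborel {a<..<b} f" and \<phi>: "continuous_on UNIV (\<phi> :: real \<Rightarrow> real)"
  shows "set_integrable lborel {a<..<b} (\<lambda>x. \<phi> x *\<^sub>R f x)"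
proof -
  have "compact (\<phi> ` {a..b})"
    using \<phi> by (intro compact_continuous_image continuous_on_subset[OF \<phi>]) auto
  then obtain B where B: "\<And>x. x \<in> {a..b} \<Longrightarrow> \<bar>\<phi> x\<bar> \<le> B"
    by (force dest!: compact_imp_bounded simp: bounded_iff)
  have [measurable]: "\<phi> \<in> borel_measurable borel"
    by (rule borel_measurable_continuous_onI[OF \<phi>])
  have [measurable]: "(\<lambda>x. indicator {a<..<b} x *\<^sub>R f x) \<in> borel_measurable lborel"
    using f by (auto simp: set_integrable_def)
  show ?thesis unfolding set_integrable_def
  proof (rule Bochner_Integration.integrable_bound)
    show "integrable lborel (\<lambda>x. B * norm (indicator {a<..<b} x *\<^sub>R f x))"
      using f by (intro integrable_mult_right integrable_norm) (simp add: set_integrable_def)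
    have "(\<lambda>x. \<phi> x *\<^sub>R (indicator {a<..<b} x *\<^sub>R f x)) \<in> borel_measurable lborel"
      by measurable
    then show "(\<lambda>x. indicator {a<..<b} x *\<^sub>R \<phi> x *\<^sub>R f x) \<in> borel_measurable lborel"
      by (simp add: mult.commute)
    have "norm (indicator {a<..<b} x *\<^sub>R \<phi> x *\<^sub>R f x) \<le> B * norm (indicator {a<..<b} x *\<^sub>R f x)" for x
      using B[of x] by (cases "x \<in> {a<..<b}") (auto intro: mult_right_mono)
    then show "AE x in lborel. norm (indicator {a<..<b} x *\<^sub>R \<phi> x *\<^sub>R f x)
        \<le> norm (B * norm (indicator {a<..<b} x *\<^sub>R f x))"
      by (intro always_eventually allI) (metis abs_ge_self order_trans real_norm_def)
  qed
qed

text \<open>Bump functions tend boundedly to the indicator of \<open>(a, b)\<close>, so by dominated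
  convergence the integral of \<open>f\<close> over every interval compactly inside
  \<open>(0, L)\<close> vanishes. Lebesgue differentiation then recovers \<open>f\<close> almost
  everywhere from these integrals.\<close>

lemma fundamental_lemma_calculus_of_variations:
  fixes f :: "real \<Rightarrow> 'a::euclidean_space"
  assumes f: "set_integrable lborel {0<..<L} f"
    and test: "\<And>\<phi> \<phi>'. test_function L \<phi> \<phi>' \<Longrightarrow> (LINT x:{0<..<L}|lborel. \<phi> x *\<^sub>R f x) = 0"
  shows "AE x in lborel. x \<in> {0<..<L} \<longrightarrow> f x = 0"
proof -
  \<comment> \<open>Extension by zero gives a function integrable over every bounded interval, as
    the differentiation theorem requires.\<close>
  define g where "g x = indicator {0<..<L} x *\<^sub>R f x" for x
  have g: "integrable lborel g" using f unfolding g_def set_integrable_def .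
  then have [measurable]: "g \<in> borel_measurable lborel" by auto
  have g_int: "set_integrable lborel {a..b} g" for a b
    using g by (intro set_integrable_subset[where A = UNIV and B = "{a..b}"])
      (auto simp: set_integrable_def)
  have zero: "integral {a..b} g = 0" if ab: "0 < a" "a < b" "b < L" for a b
  proof -
    define \<phi> where "\<phi> n x = saturation (real n * ((x - a) * (b - x)))" for n x
    have \<phi>: "(LINT x|lborel. \<phi> n x *\<^sub>R g x) = 0" for n
      using test[OF test_function_bump[of a b L n]] ab
      by (simp add: set_lebesgue_integral_def \<phi>_def g_def mult.commute)
    have [measurable]: "\<phi> n \<in> borel_measurable lborel" for n
      unfolding \<phi>_def saturation_def by measurable
    have "(\<lambda>n. LINT x|lborel. \<phi> n x *\<^sub>R g x) \<longlonglongrightarrow> (LINT x|lborel. indicator {a<..<b} x *\<^sub>R g x)"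
    proof (rule integral_dominated_convergence)
      show "integrable lborel (\<lambda>x. norm (g x))" using g by simp
      show "AE x in lborel. norm (\<phi> n x *\<^sub>R g x) \<le> norm (g x)" for n
        using saturation_bounds by (intro always_eventually allI) (simp add: \<phi>_def mult_left_le_one_le)
      have "(\<lambda>n. \<phi> n x) \<longlonglongrightarrow> indicator {a<..<b} x" for x
      proof (cases "x \<in> {a<..<b}")
        case True
        then show ?thesis unfolding \<phi>_def using tendsto_saturation[of "(x - a) * (b - x)"] by simp
      next
        case False
        then have "(x - a) * (b - x) \<le> 0" using ab by (auto simp: mult_le_0_iff)
        then have "\<phi> n x = 0" for n
          unfolding \<phi>_def by (intro saturation_nonpos mult_nonneg_nonpos[of "real n"]) auto
        then show ?thesis using False by simp
      qed
      then show "AE x in lborel. (\<lambda>n. \<phi> n x *\<^sub>R g x) \<longlonglongrightarrow> indicator {a<..<b} x *\<^sub>R g x"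
        by (intro always_eventually allI tendsto_intros)
    qed auto
    then have "(LINT x:{a<..<b}|lborel. g x) = 0"
      unfolding \<phi> set_lebesgue_integral_def using LIMSEQ_unique tendsto_const by blast
    moreover have "set_integrable lborel {a<..<b} g"
      by (rule set_integrable_subset[OF g_int[of a b]]) auto
    ultimately have "integral {a<..<b} g = 0"
      using set_borel_integral_eq_integral(2) by metis
    then show ?thesis by (simp add: integral_open_interval_real)
  qed
  have "g integrable_on cbox a b" for a b :: real
    using set_borel_integral_eq_integral(1)[OF g_int] by simp
  \<comment> \<open>Lebesgue differentiation with one-sided averages: off \<open>N\<close>, the mean
    of \<open>g\<close> over \<open>[x, x + h]\<close> tends to \<open>g x\<close>.\<close>
  then obtain N where N: "negligible N"
    "\<And>x e. \<lbrakk>x \<notin> N; 0 < e\<rbrakk> \<Longrightarrow> \<exists>d>0. \<forall>h. 0 < h \<and> h < d \<longrightarrow>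
        norm (integral (cbox x (x + h *\<^sub>R One)) g /\<^sub>R h ^ DIM(real) - g x) < e"
    using integrable_ccontinuous_explicit[of g] by metis
  have "f x = 0" if x: "x \<in> {0<..<L}" "x \<notin> N" for x
  proof (rule ccontr)
    assume "f x \<noteq> 0"
    then have "norm (g x) > 0" using x by (simp add: g_def)
    then obtain d where d: "d > 0" "\<And>h. 0 < h \<Longrightarrow> h < d \<Longrightarrow>
        norm (integral (cbox x (x + h *\<^sub>R One)) g /\<^sub>R h ^ DIM(real) - g x) < norm (g x)"
      using N(2)[OF x(2)] by blast
    \<comment> \<open>Small enough that \<open>[x, x + h]\<close> stays inside \<open>(0, L)\<close>
      and \<open>h < d\<close>. The mean is then 0, which would force
      \<open>norm (g x) < norm (g x)\<close>.\<close>
    define h where "h = min d (L - x) / 2"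
    have "0 < h" "h < d" "x + h < L" using d(1) x by (auto simp: h_def field_simps min_def)
    then show False using d(2)[of h] zero[of x "x + h"] x by simp
  qed
  moreover have "AE x in lborel. x \<notin> N"
  proof -
    \<comment> \<open>\<open>N\<close> need only be null for the completed measure, so the statement
      is transferred from there to \<open>lborel\<close>.\<close>
    have "AE x in lebesgue. x \<notin> N"
      using N(1) by (intro AE_not_in) (simp add: negligible_iff_null_sets)
    then show ?thesis by (simp add: AE_completion_iff)
  qed
  ultimately show ?thesis by (auto elim!: eventually_mono)
qed

section \<open>Almost everywhere calculus with representatives, and the closed subspace
  \<open>H_space\<close>\<close>

lemma L2_eqI:
  assumes "AE x in lborel. rep_L2 u x = rep_L2 v x"
  shows "u = v"
proof -
  have "abs_L2 (rep_L2 u) = abs_L2 (rep_L2 v)"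
    using assms
    by (intro Quotient_rel_abs[OF Quotient_L2]) (simp add: L2_rel_def square_integrable_rep_L2)
  then show ?thesis by (simp add: Quotient_abs_rep[OF Quotient_L2])
qed

lemma rep_L2_zero: "AE x in lborel. rep_L2 0 x = 0"
  using rep_abs_L2[OF square_integrable_0] by (simp add: zero_L2_def)

lemma rep_L2_add: "AE x in lborel. rep_L2 (u + v) x = rep_L2 u x + rep_L2 v x"
proof -
  have "abs_L2 (rep_L2 u) + abs_L2 (rep_L2 v) = abs_L2 (\<lambda>x. rep_L2 u x + rep_L2 v x)"
    by (rule plus_L2.abs_eq) (simp_all add: L2_rel_def square_integrable_rep_L2)
  then show ?thesis
    using rep_abs_L2[OF square_integrable_add[OF square_integrable_rep_L2[of u] square_integrable_rep_L2[of v]]]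
    by (simp add: Quotient_abs_rep[OF Quotient_L2])
qed

lemma rep_L2_scaleR: "AE x in lborel. rep_L2 (r *\<^sub>R u) x = r *\<^sub>R rep_L2 u x"
proof -
  have "r *\<^sub>R abs_L2 (rep_L2 u) = abs_L2 (\<lambda>x. r *\<^sub>R rep_L2 u x)"
    by (rule scaleR_L2.abs_eq) (simp_all add: L2_rel_def square_integrable_rep_L2)
  then show ?thesis
    using rep_abs_L2[OF square_integrable_scaleR[OF square_integrable_rep_L2[of u]], of r]
    by (simp add: Quotient_abs_rep[OF Quotient_L2])
qed

lemma subspace_L2_Ioo: "subspace (L2_Ioo L)"
proof (rule subspaceI)
  show "0 \<in> L2_Ioo L"
    using rep_L2_zero by (auto simp: L2_Ioo_def)
next
  fix u v :: "'a L2" assume "u \<in> L2_Ioo L" "v \<in> L2_Ioo L"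
  then show "u + v \<in> L2_Ioo L"
    using rep_L2_add[of u v] unfolding L2_Ioo_def mem_Collect_eq by eventually_elim auto
next
  fix u :: "'a L2" and r assume "u \<in> L2_Ioo L"
  then show "r *\<^sub>R u \<in> L2_Ioo L"
    using rep_L2_scaleR[of r u] unfolding L2_Ioo_def mem_Collect_eq by eventually_elim auto
qed

text \<open>Elements \<open>v\<close> of the subspace vanish outside \<open>(0, L)\<close>, so the
  mass of \<open>u\<close> there is at most the squared distance from \<open>u\<close> to
  \<open>v\<close>. For \<open>u\<close> in the closure it is therefore 0.\<close>

lemma closed_L2_Ioo: "closed (L2_Ioo L)"
proof -
  have "u \<in> L2_Ioo L" if u: "u \<in> closure (L2_Ioo L)" for u :: "'a L2"
  proof -
    have [measurable]: "rep_L2 w \<in> borel_measurable lborel" for w :: "'a L2"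
      using square_integrable_rep_L2[of w] by (simp add: square_integrable_def)
    let ?I = "\<integral>\<^sup>+x. ennreal (indicator (- {0<..<L}) x * (norm (rep_L2 u x))\<^sup>2) \<partial>lborel"
    have le: "?I \<le> ennreal (e\<^sup>2)" if e: "e > 0" for e
    proof -
      obtain v where v: "v \<in> L2_Ioo L" "dist v u < e"
        using u e unfolding closure_approachable by blast
      have "?I \<le> (\<integral>\<^sup>+x. ennreal ((norm (rep_L2 v x - rep_L2 u x))\<^sup>2) \<partial>lborel)"
      proof (rule nn_integral_mono_AE)
        show "AE x in lborel. ennreal (indicator (- {0<..<L}) x * (norm (rep_L2 u x))\<^sup>2)
            \<le> ennreal ((norm (rep_L2 v x - rep_L2 u x))\<^sup>2)"
          using v(1) unfolding L2_Ioo_def mem_Collect_eq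
          by eventually_elim (auto simp: indicator_def)
      qed
      also have "\<dots> = ennreal ((norm (v - u))\<^sup>2)" by (rule nn_integral_rep_L2_diff)
      also have "\<dots> \<le> ennreal (e\<^sup>2)"
        using v(2) by (intro ennreal_leI power_mono) (auto simp: dist_norm)
      finally show ?thesis .
    qed
    have "?I \<le> 0"
    proof (rule ennreal_le_epsilon)
      fix e :: real assume "e > 0"
      then show "?I \<le> 0 + ennreal e" using le[of "sqrt e"] by simp
    qed
    then have "?I = 0" by simp
    then have "AE x in lborel. ennreal (indicator (- {0<..<L}) x * (norm (rep_L2 u x))\<^sup>2) = 0"
      by (subst (asm) nn_integral_0_iff_AE) auto
    then show ?thesis
      unfolding L2_Ioo_def mem_Collect_eq
      by eventually_elim (auto simp: indicator_def split: if_splits)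
  qed
  then show ?thesis
    using closure_subset_eq by blast
qed

lemma subspace_H_space: "subspace (H_space L)"
  unfolding H_space_def using subspace_L2_Ioo by (intro subspace_Times)

lemma closed_H_space: "closed (H_space L)"
  unfolding H_space_def by (intro closed_Times closed_L2_Ioo)

text \<open>The difference of two weak derivatives annihilates every test function, so it vanishes
  on \<open>(0, L)\<close> by the fundamental lemma; outside, both are 0 by membership in
  \<open>L2_Ioo\<close>. Uniqueness is what gives the definite description in
  \<open>weak_deriv\<close> a value.\<close>

lemma has_weak_deriv_unique:
  assumes g: "has_weak_deriv L u g" and h: "has_weak_deriv L u h"
  shows "g = h"
proof (rule L2_eqI)
  have int: "set_integrable lborel {0<..<L} (rep_L2 w)" for w :: "'a L2"
    by (rule set_integrable_square_integrable[OF square_integrable_rep_L2])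
  have "AE x in lborel. x \<in> {0<..<L} \<longrightarrow> rep_L2 g x - rep_L2 h x = 0"
  proof (rule fundamental_lemma_calculus_of_variations)
    show "set_integrable lborel {0<..<L} (\<lambda>x. rep_L2 g x - rep_L2 h x)"
      by (intro set_integral_diff int)
    fix \<phi> \<phi>' assume \<phi>: "test_function L \<phi> \<phi>'"
    have parts: "(LINT x:{0<..<L}|lborel. \<phi>' x *\<^sub>R rep_L2 u x) = - (LINT x:{0<..<L}|lborel. \<phi> x *\<^sub>R rep_L2 w x)"
      if "has_weak_deriv L u w" for w
      using that \<phi> unfolding has_weak_deriv_def by blast
    have "(LINT x:{0<..<L}|lborel. \<phi> x *\<^sub>R rep_L2 g x) = (LINT x:{0<..<L}|lborel. \<phi> x *\<^sub>R rep_L2 h x)"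
      using parts[OF g] parts[OF h] by simp
    moreover have "set_integrable lborel {0<..<L} (\<lambda>x. \<phi> x *\<^sub>R rep_L2 w x)" for w :: "'a L2"
      by (intro set_integrable_scaleR_continuous int test_function_continuous[OF \<phi>])
    ultimately show "(LINT x:{0<..<L}|lborel. \<phi> x *\<^sub>R (rep_L2 g x - rep_L2 h x)) = 0"
      by (simp add: scaleR_right_diff_distrib set_integral_diff)
  qed
  moreover have "AE x in lborel. x \<notin> {0<..<L} \<longrightarrow> rep_L2 g x = 0"
    "AE x in lborel. x \<notin> {0<..<L} \<longrightarrow> rep_L2 h x = 0"
    using g h by (auto simp: has_weak_deriv_def L2_Ioo_def)
  ultimately show "AE x in lborel. rep_L2 g x = rep_L2 h x"
    by eventually_elim auto
qed

lemma weak_deriv_eqI: "has_weak_deriv L u g \<Longrightarrow> weak_deriv L u = g"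
  unfolding weak_deriv_def by (blast intro: the_equality has_weak_deriv_unique)

section \<open>Continuous functions as elements of \<open>L\<^sup>2\<close>\<close>

text \<open>Cutting off inside the quotient map makes every continuous \<open>F\<close> square
  integrable, including functions such as sinh that grow at infinity.\<close>

definition L2_of_fun :: "real \<Rightarrow> (real \<Rightarrow> 'a::euclidean_space) \<Rightarrow> 'a L2" where
  "L2_of_fun L F = abs_L2 (\<lambda>x. indicator {0<..<L} x *\<^sub>R F x)"

lemma rep_L2_of_fun:
  assumes F: "continuous_on UNIV F"
  shows "AE x in lborel. rep_L2 (L2_of_fun L F) x = indicator {0<..<L} x *\<^sub>R F x"
  unfolding L2_of_fun_def
proof (rule rep_abs_L2)
  have [measurable]: "F \<in> borel_measurable borel"
    by (rule borel_measurable_continuous_onI[OF F])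
  have "integrable lborel (\<lambda>x. indicator {0..L} x *\<^sub>R (norm (F x))\<^sup>2)"
    by (intro borel_integrable_compact) (auto intro!: continuous_intros continuous_on_subset[OF F])
  then have "integrable lborel (\<lambda>x. (norm (indicator {0<..<L} x *\<^sub>R F x))\<^sup>2)"
    by (rule Bochner_Integration.integrable_bound) (auto simp: indicator_def)
  then show "square_integrable (\<lambda>x. indicator {0<..<L} x *\<^sub>R F x)"
    by (simp add: square_integrable_def)
qed

lemma L2_of_fun_in_L2_Ioo:
  assumes "continuous_on UNIV F"
  shows "L2_of_fun L F \<in> L2_Ioo L"
  using rep_L2_of_fun[OF assms, of L] unfolding L2_Ioo_def mem_Collect_eq
  by eventually_elim auto

lemma L2_of_fun_add:
  assumes "continuous_on UNIV F" "continuous_on UNIV G"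
  shows "L2_of_fun L F + L2_of_fun L G = L2_of_fun L (\<lambda>x. F x + G x)"
  using rep_L2_add[of "L2_of_fun L F" "L2_of_fun L G"] rep_L2_of_fun[OF assms(1), of L]
    rep_L2_of_fun[OF assms(2), of L] rep_L2_of_fun[OF continuous_on_add[OF assms], of L]
  by (intro L2_eqI, eventually_elim) (simp add: scaleR_add_right)

lemma L2_of_fun_scaleR:
  assumes "continuous_on UNIV F"
  shows "r *\<^sub>R L2_of_fun L F = L2_of_fun L (\<lambda>x. r *\<^sub>R F x)"
  using rep_L2_scaleR[of r "L2_of_fun L F"] rep_L2_of_fun[OF assms, of L]
    rep_L2_of_fun[OF continuous_on_scaleR[OF continuous_on_const assms], of L r]
  by (intro L2_eqI, eventually_elim) simp

text \<open>If the class were 0, the interval \<open>(0, L)\<close> would be a null set. This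
  guarantees a nonzero eigenvector.\<close>

lemma L2_of_fun_neq_0:
  assumes "continuous_on UNIV F" "L > 0" "\<And>x. 0 < x \<Longrightarrow> x < L \<Longrightarrow> F x \<noteq> 0"
  shows "L2_of_fun L F \<noteq> 0"
proof
  assume zero: "L2_of_fun L F = 0"
  have "AE x in lborel. rep_L2 (L2_of_fun L F) x = 0"
    unfolding zero by (rule rep_L2_zero)
  then have "AE x in lborel. x \<notin> {0<..<L}"
    using rep_L2_of_fun[OF assms(1), of L]
    by eventually_elim (use assms(3) in \<open>auto simp: indicator_def split: if_splits\<close>)
  then have "emeasure lborel {0<..<L} = 0"
    by (subst (asm) AE_iff_measurable[where N = "{0<..<L}"]) auto
  then show False using \<open>L > 0\<close> by simp
qed

lemma has_value_at_L2_of_fun: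
  assumes "continuous_on UNIV F"
  shows "has_value_at L (L2_of_fun L F) a (F a)"
  unfolding has_value_at_def
proof (intro exI[of _ F] conjI refl)
  show "continuous_on {0..L} F" using assms by (rule continuous_on_subset) auto
  show "AE x in lborel. x \<in> {0<..<L} \<longrightarrow> rep_L2 (L2_of_fun L F) x = F x"
    using rep_L2_of_fun[OF assms, of L] by eventually_elim auto
qed

text \<open>Integration by parts; the boundary terms drop out because a test function vanishes at 0
  and at \<open>L\<close>, which lie outside its support.\<close>

lemma has_weak_deriv_L2_of_fun:
  fixes F F' :: "real \<Rightarrow> 'a::euclidean_space"
  assumes "L > 0" and F: "\<And>x. (F has_vector_derivative F' x) (at x)" and F': "continuous_on UNIV F'"
  shows "has_weak_deriv L (L2_of_fun L F) (L2_of_fun L F')"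
  unfolding has_weak_deriv_def
proof (intro conjI allI impI)
  have cF: "continuous_on UNIV F"
    using F by (meson continuous_at_imp_continuous_on has_vector_derivative_continuous)
  show "L2_of_fun L F \<in> L2_Ioo L" "L2_of_fun L F' \<in> L2_Ioo L"
    by (intro L2_of_fun_in_L2_Ioo cF F')+
  fix \<phi> \<phi>' assume \<phi>: "test_function L \<phi> \<phi>'"
  then have d\<phi>: "\<And>x. (\<phi> has_real_derivative \<phi>' x) (at x)" and c\<phi>': "continuous_on UNIV \<phi>'"
    and supp: "\<phi> 0 = 0" "\<phi> L = 0"
    by (auto simp: test_function_def)
  have c\<phi>: "continuous_on UNIV \<phi>" by (rule test_function_continuous[OF \<phi>])
  have int: "set_integrable lborel {0<..<L} G" if "continuous_on UNIV G" for G :: "real \<Rightarrow> 'a"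
  proof (rule set_integrable_subset)
    show "set_integrable lborel {0..L} G"
      unfolding set_integrable_def
      by (intro borel_integrable_compact continuous_on_subset[OF that]) auto
  qed auto
  \<comment> \<open>Under the integral the chosen representative may be exchanged for the continuous
    function itself.\<close>
  have rep: "(LINT x:{0<..<L}|lborel. \<psi> x *\<^sub>R rep_L2 (L2_of_fun L G) x) = (LINT x:{0<..<L}|lborel. \<psi> x *\<^sub>R G x)"
    if "continuous_on UNIV G" "continuous_on UNIV \<psi>" for G :: "real \<Rightarrow> 'a" and \<psi> :: "real \<Rightarrow> real"
    unfolding set_lebesgue_integral_def
  proof (rule integral_cong_AE)
    have [measurable]: "G \<in> borel_measurable borel" "\<psi> \<in> borel_measurable borel"
      using that by (auto intro: borel_measurable_continuous_onI)
    have [measurable]: "rep_L2 (L2_of_fun L G) \<in> borel_measurable lborel"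
      using square_integrable_rep_L2 by (auto simp: square_integrable_def)
    show "(\<lambda>x. indicator {0<..<L} x *\<^sub>R \<psi> x *\<^sub>R rep_L2 (L2_of_fun L G) x) \<in> borel_measurable lborel"
      "(\<lambda>x. indicator {0<..<L} x *\<^sub>R \<psi> x *\<^sub>R G x) \<in> borel_measurable lborel"
      by measurable
    show "AE x in lborel. indicator {0<..<L} x *\<^sub>R \<psi> x *\<^sub>R rep_L2 (L2_of_fun L G) x
        = indicator {0<..<L} x *\<^sub>R \<psi> x *\<^sub>R G x"
      using rep_L2_of_fun[OF that(1), of L] by eventually_elim (auto simp: indicator_def)
  qed
  have c: "continuous_on UNIV (\<lambda>x. \<phi>' x *\<^sub>R F x)" "continuous_on UNIV (\<lambda>x. \<phi> x *\<^sub>R F' x)"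
    by (intro continuous_intros cF F' c\<phi> c\<phi>')+
  have "((\<lambda>x. \<phi>' x *\<^sub>R F x + \<phi> x *\<^sub>R F' x) has_integral \<phi> L *\<^sub>R F L - \<phi> 0 *\<^sub>R F 0) {0..L}"
  proof (rule fundamental_theorem_of_calculus)
    fix x
    have "((\<lambda>x. \<phi> x *\<^sub>R F x) has_vector_derivative \<phi> x *\<^sub>R F' x + \<phi>' x *\<^sub>R F x) (at x)"
      by (intro has_vector_derivative_scaleR d\<phi> F)
    then show "((\<lambda>x. \<phi> x *\<^sub>R F x) has_vector_derivative \<phi>' x *\<^sub>R F x + \<phi> x *\<^sub>R F' x) (at x within {0..L})"
      by (simp add: add.commute has_vector_derivative_at_within)
  qed (use \<open>L > 0\<close> in auto)
  then have "integral {0..L} (\<lambda>x. \<phi>' x *\<^sub>R F x + \<phi> x *\<^sub>R F' x) = 0"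
    by (simp add: supp integral_unique)
  then have "(LINT x:{0<..<L}|lborel. \<phi>' x *\<^sub>R F x + \<phi> x *\<^sub>R F' x) = 0"
    using set_borel_integral_eq_integral(2)[OF int[OF continuous_on_add[OF c]]]
    by (simp add: integral_open_interval_real)
  then have "(LINT x:{0<..<L}|lborel. \<phi>' x *\<^sub>R F x) + (LINT x:{0<..<L}|lborel. \<phi> x *\<^sub>R F' x) = 0"
    by (simp add: set_integral_add(2)[OF int[OF c(1)] int[OF c(2)]])
  then show "(LINT x:{0<..<L}|lborel. \<phi>' x *\<^sub>R rep_L2 (L2_of_fun L F) x) =
      - (LINT x:{0<..<L}|lborel. \<phi> x *\<^sub>R rep_L2 (L2_of_fun L F') x)"
    by (simp add: rep cF F' c\<phi> c\<phi>' eq_neg_iff_add_eq_0)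
qed

section \<open>A slowly decaying eigenfunction\<close>

text \<open>Intermediate value theorem for \<open>\<epsilon> * sinh (x * L) - c * x\<close>: it is
  negative just to the right of 0, where its slope is \<open>\<epsilon> * L - c < 0\<close>, and
  nonnegative at \<open>k * ln (inverse \<epsilon>) / c\<close>, which thus bounds the root.\<close>

lemma eigenvalue_exists:
  fixes c L \<kappa> :: real
  assumes c: "c > 0" and L: "L > 0" and \<kappa>: "\<kappa> > c / L"
  shows "\<exists>\<epsilon>0>0. \<forall>\<epsilon>\<in>{0<..<\<epsilon>0}. \<exists>\<mu>>0. \<epsilon> * sinh (\<mu> * L) = c * \<mu>
    \<and> \<epsilon> * cosh (\<mu> * L) \<le> \<kappa> * ln (inverse \<epsilon>)"
proof -
  \<comment> \<open>The gap \<open>\<kappa> - k\<close> later absorbs the summand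
    \<open>\<epsilon>\<close> in \<open>\<epsilon> + k * l \<le> \<kappa> * l\<close>.\<close>
  obtain k where "c / L < k" "k < \<kappa>" using dense[OF \<kappa>] by blast
  moreover have "0 < c / L" using c L by simp
  ultimately have k: "c / L < k" "k < \<kappa>" "k > 0" by linarith+
  \<comment> \<open>At the right end point \<open>\<mu>1\<close> one has
    \<open>exp (\<mu>1 * L) = exp (a * ln (inverse \<epsilon>))\<close>, that is, \<epsilon> to the
    power -a. As \<open>a > 1\<close>, multiplying by \<epsilon> still leaves a quantity that
    outgrows the logarithm.\<close>
  define a where "a = k * L / c"
  have a: "a > 1" using k(1) c L by (simp add: a_def field_simps)
  have "eventually (\<lambda>\<epsilon>. k * ln (inverse \<epsilon>) \<le> \<epsilon> * ((exp (a * ln (inverse \<epsilon>)) - exp (- (a * ln (inverse \<epsilon>)))) / 2)) (at_right 0)"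
    using k(3) a by real_asymp
  moreover have "eventually (\<lambda>\<epsilon>. \<epsilon> \<le> (\<kappa> - k) * ln (inverse \<epsilon>)) (at_right 0)"
    using k(2) by real_asymp
  moreover have "eventually (\<lambda>\<epsilon>. \<epsilon> < 1 \<and> \<epsilon> < c / L) (at_right 0)"
    using c L by (auto simp: eventually_at_right_field intro!: exI[of _ "min 1 (c/L)"])
  ultimately have "eventually (\<lambda>\<epsilon>.
    (k * ln (inverse \<epsilon>) \<le> \<epsilon> * ((exp (a * ln (inverse \<epsilon>)) - exp (- (a * ln (inverse \<epsilon>)))) / 2)
     \<and> \<epsilon> \<le> (\<kappa> - k) * ln (inverse \<epsilon>)) \<and> \<epsilon> < 1 \<and> \<epsilon> < c / L) (at_right 0)"
    by eventually_elim blast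
  then obtain \<epsilon>0 :: real where "\<epsilon>0 > 0" and
    ev: "\<And>\<epsilon>. 0 < \<epsilon> \<Longrightarrow> \<epsilon> < \<epsilon>0 \<Longrightarrow>
      (k * ln (inverse \<epsilon>) \<le> \<epsilon> * ((exp (a * ln (inverse \<epsilon>)) - exp (- (a * ln (inverse \<epsilon>)))) / 2)
     \<and> \<epsilon> \<le> (\<kappa> - k) * ln (inverse \<epsilon>)) \<and> \<epsilon> < 1 \<and> \<epsilon> < c / L"
    unfolding eventually_at_right_field by blast
  have "\<exists>\<mu>>0. \<epsilon> * sinh (\<mu> * L) = c * \<mu> \<and> \<epsilon> * cosh (\<mu> * L) \<le> \<kappa> * ln (inverse \<epsilon>)"
    if \<epsilon>: "0 < \<epsilon>" "\<epsilon> < \<epsilon>0" for \<epsilon>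
  proof -
    define l where "l = ln (inverse \<epsilon>)"
    have l: "l > 0" using ev[OF \<epsilon>] \<epsilon> by (simp add: l_def ln_inverse)
    define \<mu>1 where "\<mu>1 = k * l / c"
    have \<mu>1: "\<mu>1 > 0" using k l c by (simp add: \<mu>1_def)
    define f where "f x = \<epsilon> * sinh (x * L) - c * x" for x
    have f0: "f 0 = 0" by (simp add: f_def)
    have f1: "f \<mu>1 \<ge> 0"
    proof -
      have "\<mu>1 * L = a * l" "c * \<mu>1 = k * l" using c by (simp_all add: \<mu>1_def a_def)
      then show ?thesis using ev[OF \<epsilon>] by (simp add: f_def sinh_field_def l_def)
    qed
    have "(f has_real_derivative \<epsilon> * L - c) (at 0)"
      unfolding f_def by (auto intro!: derivative_eq_intros)
    moreover have "\<epsilon> * L - c < 0" using ev[OF \<epsilon>] L by (simp add: field_simps)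
    ultimately obtain d where d: "d > 0" "\<And>h. 0 < h \<Longrightarrow> h < d \<Longrightarrow> f h < f 0"
      using DERIV_neg_dec_right[of f "\<epsilon> * L - c" 0] by (metis add_0)
    \<comment> \<open>The root 0 of \<open>f\<close> would give the zero pair, so the search starts
      at a positive point where \<open>f\<close> is negative; halving keeps it below both
      \<open>d\<close> and \<open>\<mu>1\<close>.\<close>
    define \<mu>0 where "\<mu>0 = min \<mu>1 d / 2"
    have \<mu>0: "0 < \<mu>0" "\<mu>0 \<le> \<mu>1" "f \<mu>0 < 0"
      using d(1) \<mu>1 f0 d(2)[of \<mu>0] by (auto simp: \<mu>0_def)
    have "continuous_on {\<mu>0..\<mu>1} f" unfolding f_def by (intro continuous_intros)
    then obtain \<mu> where \<mu>: "\<mu>0 \<le> \<mu>" "\<mu> \<le> \<mu>1" "f \<mu> = 0"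
      using IVT'[of f \<mu>0 0 \<mu>1] f1 \<mu>0 by auto
    have sinh: "\<epsilon> * sinh (\<mu> * L) = c * \<mu>" using \<mu>(3) by (simp add: f_def)
    have "(\<epsilon> * cosh (\<mu> * L))\<^sup>2 = \<epsilon>\<^sup>2 + (\<epsilon> * sinh (\<mu> * L))\<^sup>2"
      by (simp add: power_mult_distrib cosh_square_eq algebra_simps)
    also have "\<dots> \<le> \<epsilon>\<^sup>2 + (k * l)\<^sup>2"
    proof -
      have "c * \<mu> \<le> k * l" using \<mu>(2) c by (simp add: \<mu>1_def field_simps)
      then show ?thesis unfolding sinh using \<mu> \<mu>0 c \<epsilon> by (intro add_mono power_mono) auto
    qed
    also have "\<dots> \<le> (\<epsilon> + k * l)\<^sup>2"
      using \<epsilon> k l by (simp add: power2_sum)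
    also have "\<dots> \<le> (\<kappa> * l)\<^sup>2"
      using ev[OF \<epsilon>] \<epsilon> k l by (intro power_mono) (auto simp: l_def algebra_simps)
    finally have "\<epsilon> * cosh (\<mu> * L) \<le> \<kappa> * l"
      by (rule power2_le_imp_le) (use k l in auto)
    then show ?thesis using sinh \<mu> \<mu>0 by (intro exI[of _ \<mu>]) (auto simp: l_def)
  qed
  then show ?thesis using \<open>\<epsilon>0 > 0\<close> by auto
qed

text \<open>By the addition theorem for sinh, the coupling term splits into a cosh part, which
  cancels the derivative term exactly when \<open>\<epsilon> * sinh (\<mu> * L) = c * \<mu>\<close>,
  and a multiple of the component itself. Scaling the unit of \<open>'k\<close> treats real and
  complex values at once.\<close>

lemma sinh_eigenfunction:
  fixes c L \<epsilon> \<mu> :: real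
  assumes "L > 0" "\<epsilon> > 0" and \<mu>: "\<epsilon> * sinh (\<mu> * L) = c * \<mu>"
  defines "z \<equiv> (L2_of_fun L (\<lambda>x. sinh (\<mu> * x) *\<^sub>R (1 :: 'k::{real_normed_field, euclidean_space})),
    L2_of_fun L (\<lambda>x. sinh (\<mu> * (L - x)) *\<^sub>R (1 :: 'k)))"
  shows "z \<in> dom_A L"
    and "op_A c L z + \<epsilon> *\<^sub>R op_B z = - (\<epsilon> * cosh (\<mu> * L)) *\<^sub>R z"
proof -
  define u v u' v' :: "real \<Rightarrow> 'k" where "u x = sinh (\<mu> * x) *\<^sub>R 1"
    and "v x = sinh (\<mu> * (L - x)) *\<^sub>R 1" and "u' x = (\<mu> * cosh (\<mu> * x)) *\<^sub>R 1"
    and "v' x = - (\<mu> * cosh (\<mu> * (L - x))) *\<^sub>R 1" for x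
  have z: "z = (L2_of_fun L u, L2_of_fun L v)"
    by (simp add: z_def u_def[abs_def] v_def[abs_def])
  have cont: "continuous_on UNIV u" "continuous_on UNIV v" "continuous_on UNIV u'" "continuous_on UNIV v'"
    unfolding u_def[abs_def] v_def[abs_def] u'_def[abs_def] v'_def[abs_def]
    by (intro continuous_intros)+
  have "(u has_vector_derivative u' x) (at x)" "(v has_vector_derivative v' x) (at x)" for x
    unfolding u_def[abs_def] v_def[abs_def] u'_def v'_def
    by (rule has_vector_derivative_eq_rhs, (rule derivative_intros)+,
        auto intro!: derivative_eq_intros)+
  then have weak: "has_weak_deriv L (L2_of_fun L u) (L2_of_fun L u')"
    "has_weak_deriv L (L2_of_fun L v) (L2_of_fun L v')"
    using cont \<open>L > 0\<close> by (auto intro: has_weak_deriv_L2_of_fun)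
  have "has_value_at L (L2_of_fun L u) 0 0" "has_value_at L (L2_of_fun L v) L 0"
    using has_value_at_L2_of_fun[OF cont(1), of L 0] has_value_at_L2_of_fun[OF cont(2), of L L]
    by (simp_all add: u_def v_def)
  then show "z \<in> dom_A L"
    using weak by (auto simp: z dom_A_def H1_def)
  define l where "l = - (\<epsilon> * cosh (\<mu> * L))"
  \<comment> \<open>First component: sinh is expanded at the difference of \<open>\<mu> * L\<close>
    and \<open>\<mu> * x\<close>.\<close>
  have scalar1: "- c * (\<mu> * cosh (\<mu> * x)) + \<epsilon> * sinh (\<mu> * (L - x)) = l * sinh (\<mu> * x)" for x
  proof -
    have eq: "sinh (\<mu> * (L - x)) = sinh (\<mu> * L) * cosh (\<mu> * x) - cosh (\<mu> * L) * sinh (\<mu> * x)"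
      by (simp add: right_diff_distrib sinh_diff)
    have "\<epsilon> * sinh (\<mu> * (L - x)) = c * \<mu> * cosh (\<mu> * x) + l * sinh (\<mu> * x)"
      unfolding \<mu>[symmetric] l_def eq by (simp add: algebra_simps)
    then show ?thesis by simp
  qed
  have eq1: "(- c) *\<^sub>R u' x + \<epsilon> *\<^sub>R v x = l *\<^sub>R u x" for x
    using arg_cong[OF scalar1[of x], of "\<lambda>r. r *\<^sub>R (1 :: 'k)"]
    by (simp add: u_def v_def u'_def scaleR_left_distrib scaleR_left_diff_distrib)
  \<comment> \<open>Second component: the mirror image of the first under the reflection of
    \<open>x\<close> to \<open>L - x\<close>.\<close>
  have scalar2: "c * (- (\<mu> * cosh (\<mu> * (L - x)))) + \<epsilon> * sinh (\<mu> * x) = l * sinh (\<mu> * (L - x))" for x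
  proof -
    have "sinh (\<mu> * x) = sinh (\<mu> * L - \<mu> * (L - x))" by (simp add: algebra_simps)
    also have "\<dots> = sinh (\<mu> * L) * cosh (\<mu> * (L - x)) - cosh (\<mu> * L) * sinh (\<mu> * (L - x))"
      by (rule sinh_diff)
    finally have eq: "sinh (\<mu> * x) =
        sinh (\<mu> * L) * cosh (\<mu> * (L - x)) - cosh (\<mu> * L) * sinh (\<mu> * (L - x))" .
    have "\<epsilon> * sinh (\<mu> * x) = c * \<mu> * cosh (\<mu> * (L - x)) + l * sinh (\<mu> * (L - x))"
      unfolding \<mu>[symmetric] l_def eq by (simp add: algebra_simps)
    then show ?thesis by simp
  qed
  have eq2: "c *\<^sub>R v' x + \<epsilon> *\<^sub>R u x = l *\<^sub>R v x" for x
    using arg_cong[OF scalar2[of x], of "\<lambda>r. r *\<^sub>R (1 :: 'k)"]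
    by (simp add: u_def v_def v'_def scaleR_left_distrib scaleR_left_diff_distrib)
  have "(- c) *\<^sub>R L2_of_fun L u' + \<epsilon> *\<^sub>R L2_of_fun L v = l *\<^sub>R L2_of_fun L u"
    "c *\<^sub>R L2_of_fun L v' + \<epsilon> *\<^sub>R L2_of_fun L u = l *\<^sub>R L2_of_fun L v"
    by (simp_all only: L2_of_fun_scaleR L2_of_fun_add cont continuous_on_scaleR continuous_on_const eq1 eq2)
  then show "op_A c L z + \<epsilon> *\<^sub>R op_B z = - (\<epsilon> * cosh (\<mu> * L)) *\<^sub>R z"
    by (simp add: z op_A_def op_B_def weak_deriv_eqI[OF weak(1)] weak_deriv_eqI[OF weak(2)] flip: l_def)
qed

section \<open>From the eigenvector to a lower bound for the operator norm\<close>

theorem theorem2: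
  fixes c L \<kappa> :: real
  assumes "c > 0" and "L > 0" and "\<kappa> > c / L"
  shows "\<exists>K > 0. \<exists>\<epsilon>\<^sub>0 > 0. \<forall>\<epsilon> \<in> {0<..<\<epsilon>\<^sub>0}.
    \<forall>T :: real \<Rightarrow> 'k::{real_normed_field, euclidean_space} L2 \<times> 'k L2 \<Rightarrow> 'k L2 \<times> 'k L2.
      generates (H_space L) (dom_A L) (\<lambda>z. op_A c L z + \<epsilon> *\<^sub>R op_B z) T \<longrightarrow>
      (\<forall>t\<ge>0. onorm_on (H_space L) (T t) \<ge> K * exp (- (\<kappa> * ln (inverse \<epsilon>)) * t))"
proof -
  obtain \<epsilon>\<^sub>0 where "\<epsilon>\<^sub>0 > 0" and \<epsilon>\<^sub>0: "\<And>\<epsilon>. \<epsilon> \<in> {0<..<\<epsilon>\<^sub>0} \<Longrightarrow>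
      \<exists>\<mu>>0. \<epsilon> * sinh (\<mu> * L) = c * \<mu> \<and> \<epsilon> * cosh (\<mu> * L) \<le> \<kappa> * ln (inverse \<epsilon>)"
    using eigenvalue_exists[OF assms] by blast
  have "1 * exp (- (\<kappa> * ln (inverse \<epsilon>)) * t) \<le> onorm_on (H_space L) (T t)"
    if \<epsilon>: "\<epsilon> \<in> {0<..<\<epsilon>\<^sub>0}" and "t \<ge> 0"
      and gen: "generates (H_space L) (dom_A L) (\<lambda>z. op_A c L z + \<epsilon> *\<^sub>R op_B z) T"
    for \<epsilon> t and T :: "real \<Rightarrow> 'k L2 \<times> 'k L2 \<Rightarrow> 'k L2 \<times> 'k L2"
  proof -
    obtain \<mu> where \<mu>: "\<mu> > 0" "\<epsilon> * sinh (\<mu> * L) = c * \<mu>"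
      and le: "\<epsilon> * cosh (\<mu> * L) \<le> \<kappa> * ln (inverse \<epsilon>)"
      using \<epsilon>\<^sub>0[OF \<epsilon>] by blast
    define l where "l = - (\<epsilon> * cosh (\<mu> * L))"
    define u :: "real \<Rightarrow> 'k" where "u x = sinh (\<mu> * x) *\<^sub>R 1" for x
    define z where "z = (L2_of_fun L u, L2_of_fun L (\<lambda>x. sinh (\<mu> * (L - x)) *\<^sub>R (1 :: 'k)))"
    have z: "z \<in> dom_A L" "op_A c L z + \<epsilon> *\<^sub>R op_B z = l *\<^sub>R z"
      using sinh_eigenfunction[OF \<open>L > 0\<close> _ \<mu>(2), where 'k = 'k] \<epsilon>
      by (simp_all add: z_def u_def[abs_def] l_def)
    \<comment> \<open>Since \<open>\<mu> > 0\<close>, the function \<open>sinh (\<mu> * x)\<close>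
      has no zero in \<open>(0, L)\<close>.\<close>
    have "L2_of_fun L u \<noteq> 0"
      using \<open>L > 0\<close> \<mu>(1) unfolding u_def
      by (intro L2_of_fun_neq_0 continuous_intros) auto
    then have "z \<noteq> 0" by (simp add: z_def zero_prod_def)
    have "l \<le> 0" using \<epsilon> by (simp add: l_def)
    have "z \<in> H_space L" and bl: "bounded_linear_self (H_space L) (T t)"
      using gen z(1) \<open>t \<ge> 0\<close> by (auto simp: generates_def C0_semigroup_on_def)
    have "exp (- (\<kappa> * ln (inverse \<epsilon>)) * t) \<le> exp (l * t)"
      using le \<open>t \<ge> 0\<close> by (simp add: l_def mult_right_mono)
    also have "\<dots> = norm (T t z) / norm z"
      using generator_eigenvector[OF gen closed_H_space subspace_H_space z \<open>l \<le> 0\<close> \<open>t \<ge> 0\<close>] \<open>z \<noteq> 0\<close>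
      by simp
    also have "\<dots> \<le> onorm_on (H_space L) (T t)"
      by (rule onorm_on_ge[OF bl \<open>z \<in> H_space L\<close>])
    finally show ?thesis by simp
  qed
  then show ?thesis using \<open>\<epsilon>\<^sub>0 > 0\<close> by (intro exI[of _ 1] conjI exI[of _ \<epsilon>\<^sub>0]) auto
qed

end
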